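(* (a) Let $N\ge 1$ be an integer and let $h_0(y),\dots,h_N(y)$ be polynomials with real coefficients, $h_0(y)=1$, $\deg h_i\le \frac N2-\left|\frac N2-i\right|$, such that $h(z,y)=\sum_{i=0}^N h_i(y)z^i$ satisfies $h(z,y)\neq 0$ for all $|z|\le 1$ and all $-1\le y\le 1$; let $\kappa=\max_i\deg h_i$. Consider the measure on $[-1,1]^2$ $$d\mu(x,y)=\frac{4}{\pi^2}\frac{\sqrt{1-x^2}\sqrt{1-y^2}}{|h(z,y)|^2}\,dx\,dy,\qquad x=\tfrac12(z+1/z),\ |z|=1.$$ Then for $n\ge\lceil\frac{N+1}{2}\rceil$ and $m\ge0$ with $m\ge\kappa-1$, the lexicographical recurrence coefficients of $\mu$ satisfy $$A_{n,m}=\begin{bmatrix}\frac12 I_{m-\kappa+1}&0\\0&C_{n,m}\end{bmatrix},\qquad B_{n,m}=\begin{bmatrix}0&0\\0&D_{n,m}\end{bmatrix},$$ where $C_{n,m}$ is a $\kappa\times\kappa$ lower triangular matrix with positive diagonal entries and $D_{n,m}$ is a symmetric $\kappa\times\kappa$ matrix. (b) Let $N\ge1$, let $a_1,\dots,a_N\in\mathbb R$ with $0<|a_i|<1$, $\omega(z,w)=\prod_{i=1}^N(1+a_izw)$, and let $$d\mu(x,y)=\frac{4}{\pi^2}\frac{\sqrt{1-x^2}\sqrt{1-y^2}}{|\omega(z,w)\,\omega(z,1/w)|^2}\,dx\,dy$$ on $[-1,1]^2$, with $x=\frac12(z+1/z)$, $y=\frac12(w+1/w)$, $|z|=|w|=1$.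 Then for $n>2N$ and $m>2N$, $$A_{n,m}=\tfrac12 I_{m+1},\quad B_{n,m}=0,\qquad \tilde A_{n,m}=\tfrac12 I_{n+1},\quad \tilde B_{n,m}=0.$$
   Context: Lexicographical ordering: $(i,j)<_{\rm lex}(i_1,j_1)$ iff $i<i_1$, or $i=i_1$ and $j<j_1$. For a measure $\mu$ and $0\le l\le m$, $p^l_{n,m}$ is the unique polynomial that is a linear combination of $x^iy^j$ with $0\le j\le m$ and $(i,j)\le_{\rm lex}(n,l)$, has positive coefficient of $x^ny^l$, satisfies $\int(p^l_{n,m})^2d\mu=1$, and is orthogonal to all $x^iy^j$ with $0\le i<n,\ 0\le j\le m$ or $i=n,\ 0\le j<l$. Put $\mathbb P_{n,m}=[p^0_{n,m},\dots,p^m_{n,m}]^t$. Then $$x\mathbb P_{n,m}=A_{n+1,m}\mathbb P_{n+1,m}+B_{n,m}\mathbb P_{n,m}+A_{n,m}^t\mathbb P_{n-1,m},$$ with $(m+1)\times(m+1)$ matrices $A_{n,m}=\int x\,\mathbb P_{n-1,m}\mathbb P_{n,m}^t\,d\mu$ and $B_{n,m}=\int x\,\mathbb P_{n,m}\mathbb P_{n,m}^t\,d\mu$. Similarly, in the reverse lexicographical ordering, for $0\le l\le n$, $\tilde p^l_{n,m}$ is the unique polynomial that is a linear combination of $x^iy^j$ with $0\le i\le n$ and either $j<m$, or $j=m$ and $i\le l$, has positive coefficient of $x^ly^m$, has norm one in $L^2(\mu)$, and is orthogonal to all $x^iy^j$ with $0\le j<m,\ 0\le i\le n$ or $j=m,\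 0\le i<l$. With $\tilde{\mathbb P}_{n,m}=[\tilde p^0_{n,m},\dots,\tilde p^n_{n,m}]^t$, $$y\tilde{\mathbb P}_{n,m}=\tilde A_{n,m+1}\tilde{\mathbb P}_{n,m+1}+\tilde B_{n,m}\tilde{\mathbb P}_{n,m}+\tilde A_{n,m}^t\tilde{\mathbb P}_{n,m-1},$$ with $(n+1)\times(n+1)$ matrices $\tilde A_{n,m}=\int y\,\tilde{\mathbb P}_{n,m-1}\tilde{\mathbb P}_{n,m}^t\,d\mu$ and $\tilde B_{n,m}=\int y\,\tilde{\mathbb P}_{n,m}\tilde{\mathbb P}_{n,m}^t\,d\mu$. $I_s$ is the $s\times s$ identity matrix; blocks of size $0$ are absent. *)

theory Defs
  imports "HOL-Analysis.Analysis" "Jordan_Normal_Form.Matrix"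
begin

(* A bivariate polynomial is a real poly poly whose outer variable is x:
   coeff (coeff p i) j is the coefficient of x^i y^j. *)
definition eval2 :: "real poly poly \<Rightarrow> real \<Rightarrow> real \<Rightarrow> real" where
  "eval2 p x y = poly (poly p [:x:]) y"

lemma eval2_altdef:
  "eval2 p x y = (\<Sum>i\<le>degree p. \<Sum>j\<le>degree (coeff p i). coeff (coeff p i) j * x ^ i * y ^ j)"
proof -
  have "eval2 p x y = (\<Sum>i\<le>degree p. poly (coeff p i) y * x ^ i)"
    by (simp add: eval2_def poly_altdef[of p] poly_sum)
  then show ?thesis
    by (simp add: poly_altdef sum_distrib_left mult_ac)
qed

section \<open>Orthonormal polynomials and recurrence coefficients\<close>

definition is_lex_onp ::
  "(real \<times> real) measure \<Rightarrow> nat \<Rightarrow> nat \<Rightarrow> nat \<Rightarrow> real poly poly \<Rightarrow> bool" where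
  "is_lex_onp \<mu> n m l p \<longleftrightarrow>
     (\<forall>i j. coeff (coeff p i) j \<noteq> 0 \<longrightarrow> j \<le> m \<and> (i < n \<or> (i = n \<and> j \<le> l))) \<and>
     coeff (coeff p n) l > 0 \<and>
     (\<integral>(x, y). (eval2 p x y)\<^sup>2 \<partial>\<mu>) = 1 \<and>
     (\<forall>i j. (i < n \<and> j \<le> m) \<or> (i = n \<and> j < l) \<longrightarrow>
        (\<integral>(x, y). eval2 p x y * (x ^ i * y ^ j) \<partial>\<mu>) = 0)"

definition lex_onp :: "(real \<times> real) measure \<Rightarrow> nat \<Rightarrow> nat \<Rightarrow> nat \<Rightarrow> real poly poly" where
  "lex_onp \<mu> n m l = (THE p. is_lex_onp \<mu> n m l p)"

definition is_rlex_onp ::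
  "(real \<times> real) measure \<Rightarrow> nat \<Rightarrow> nat \<Rightarrow> nat \<Rightarrow> real poly poly \<Rightarrow> bool" where
  "is_rlex_onp \<mu> n m l p \<longleftrightarrow>
     (\<forall>i j. coeff (coeff p i) j \<noteq> 0 \<longrightarrow> i \<le> n \<and> (j < m \<or> (j = m \<and> i \<le> l))) \<and>
     coeff (coeff p l) m > 0 \<and>
     (\<integral>(x, y). (eval2 p x y)\<^sup>2 \<partial>\<mu>) = 1 \<and>
     (\<forall>i j. (j < m \<and> i \<le> n) \<or> (j = m \<and> i < l) \<longrightarrow>
        (\<integral>(x, y). eval2 p x y * (x ^ i * y ^ j) \<partial>\<mu>) = 0)"

definition rlex_onp :: "(real \<times> real) measure \<Rightarrow> nat \<Rightarrow> nat \<Rightarrow> nat \<Rightarrow> real poly poly" where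
  "rlex_onp \<mu> n m l = (THE p. is_rlex_onp \<mu> n m l p)"

(* Row and column index l (from 0 to m, respectively n) belongs to the polynomial with
   superscript l.  Because of the truncated subtraction, A_lex is meaningful only for n > 0
   and A_rlex only for m > 0. *)
definition A_lex :: "(real \<times> real) measure \<Rightarrow> nat \<Rightarrow> nat \<Rightarrow> real mat" where
  "A_lex \<mu> n m = Matrix.mat (m + 1) (m + 1)
     (\<lambda>(k, l). \<integral>(x, y). x * eval2 (lex_onp \<mu> (n - 1) m k) x y * eval2 (lex_onp \<mu> n m l) x y \<partial>\<mu>)"

definition B_lex :: "(real \<times> real) measure \<Rightarrow> nat \<Rightarrow> nat \<Rightarrow> real mat" where
  "B_lex \<mu> n m = Matrix.mat (m + 1) (m + 1)
     (\<lambda>(k, l). \<integral>(x, y). x * eval2 (lex_onp \<mu> n m k) x y * eval2 (lex_onp \<mu> n m l) x y \<partial>\<mu>)"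

definition A_rlex :: "(real \<times> real) measure \<Rightarrow> nat \<Rightarrow> nat \<Rightarrow> real mat" where
  "A_rlex \<mu> n m = Matrix.mat (n + 1) (n + 1)
     (\<lambda>(k, l). \<integral>(x, y). y * eval2 (rlex_onp \<mu> n (m - 1) k) x y * eval2 (rlex_onp \<mu> n m l) x y \<partial>\<mu>)"

definition B_rlex :: "(real \<times> real) measure \<Rightarrow> nat \<Rightarrow> nat \<Rightarrow> real mat" where
  "B_rlex \<mu> n m = Matrix.mat (n + 1) (n + 1)
     (\<lambda>(k, l). \<integral>(x, y). y * eval2 (rlex_onp \<mu> n m k) x y * eval2 (rlex_onp \<mu> n m l) x y \<partial>\<mu>)"

section \<open>The measures\<close>

(* The solution z of x = (z + 1/z)/2, |z| = 1, in the closed upper half plane; the other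
   solution is its conjugate, and the densities below do not depend on the choice. *)
definition circle_pt :: "real \<Rightarrow> complex" where
  "circle_pt x = Complex x (sqrt (1 - x\<^sup>2))"

lemma circle_pt_iff:
  assumes "-1 \<le> x" "x \<le> 1"
  shows "norm z = 1 \<and> complex_of_real x = (z + 1 / z) / 2 \<longleftrightarrow>
         z = circle_pt x \<or> z = cnj (circle_pt x)"
proof -
  have le: "x\<^sup>2 \<le> 1"
    using assms by (simp add: abs_square_le_1 abs_le_iff)
  have sq: "(sqrt (1 - x\<^sup>2))\<^sup>2 = 1 - x\<^sup>2"
    using le by simp
  have norm1: "norm z = 1 \<longleftrightarrow> (Re z)\<^sup>2 + (Im z)\<^sup>2 = 1"
    by (simp add: cmod_def)
  have re: "(z + 1 / z) / 2 = complex_of_real (Re z)" if "norm z = 1"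
  proof -
    have "1 / z = cnj z"
      using that complex_div_cnj[of 1 z] by simp
    then show ?thesis
      by (simp add: complex_add_cnj)
  qed
  have "norm z = 1 \<and> complex_of_real x = (z + 1 / z) / 2 \<longleftrightarrow> norm z = 1 \<and> Re z = x"
    using re by (metis of_real_eq_iff)
  also have "\<dots> \<longleftrightarrow> Re z = x \<and> (Im z)\<^sup>2 = (sqrt (1 - x\<^sup>2))\<^sup>2"
    unfolding norm1 sq by auto
  also have "\<dots> \<longleftrightarrow> z = circle_pt x \<or> z = cnj (circle_pt x)"
    unfolding power2_eq_iff by (auto simp: circle_pt_def complex_eq_iff)
  finally show ?thesis .
qed

definition weighted_measure :: "(real \<Rightarrow> real \<Rightarrow> real) \<Rightarrow> (real \<times> real) measure" where
  "weighted_measure d = density lborel (\<lambda>(x, y). ennreal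
     (indicator ({-1..1} \<times> {-1..1}) (x, y) *
      (4 / pi\<^sup>2 * (sqrt (1 - x\<^sup>2) * sqrt (1 - y\<^sup>2) / d x y))))"

definition h_eval :: "nat \<Rightarrow> (nat \<Rightarrow> real poly) \<Rightarrow> complex \<Rightarrow> real \<Rightarrow> complex" where
  "h_eval N h z y = (\<Sum>i=0..N. complex_of_real (poly (h i) y) * z ^ i)"

lemma norm_h_eval_cnj: "norm (h_eval N h (cnj z) y) = norm (h_eval N h z y)"
proof -
  have "h_eval N h (cnj z) y = cnj (h_eval N h z y)"
    by (simp add: h_eval_def)
  then show ?thesis
    by simp
qed

definition mu_h :: "nat \<Rightarrow> (nat \<Rightarrow> real poly) \<Rightarrow> (real \<times> real) measure" where
  "mu_h N h = weighted_measure (\<lambda>x y. (norm (h_eval N h (circle_pt x) y))\<^sup>2)"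

definition omega :: "nat \<Rightarrow> (nat \<Rightarrow> real) \<Rightarrow> complex \<Rightarrow> complex \<Rightarrow> complex" where
  "omega N a z w = (\<Prod>i=1..N. 1 + complex_of_real (a i) * z * w)"

lemma norm_omega_cnj:
  assumes "norm w = 1"
  shows "norm (omega N a (cnj z) w * omega N a (cnj z) (1 / w)) =
         norm (omega N a z w * omega N a z (1 / w))"
    and "norm (omega N a z (cnj w) * omega N a z (1 / cnj w)) =
         norm (omega N a z w * omega N a z (1 / w))"
proof -
  have w: "1 / w = cnj w" "1 / cnj w = w"
    using assms complex_div_cnj[of 1 w] complex_div_cnj[of 1 "cnj w"] by simp_all
  have "omega N a (cnj z) w * omega N a (cnj z) (1 / w) =
        cnj (omega N a z w * omega N a z (1 / w))"
    by (simp add: omega_def w)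
  then show "norm (omega N a (cnj z) w * omega N a (cnj z) (1 / w)) =
             norm (omega N a z w * omega N a z (1 / w))"
    by (metis complex_mod_cnj)
  show "norm (omega N a z (cnj w) * omega N a z (1 / cnj w)) =
        norm (omega N a z w * omega N a z (1 / w))"
    by (simp add: w mult.commute)
qed

definition mu_omega :: "nat \<Rightarrow> (nat \<Rightarrow> real) \<Rightarrow> (real \<times> real) measure" where
  "mu_omega N a = weighted_measure (\<lambda>x y.
     (norm (omega N a (circle_pt x) (circle_pt y) *
            omega N a (circle_pt x) (1 / circle_pt y)))\<^sup>2)"

end

theory Submission
  imports Defs "HOL-Complex_Analysis.Cauchy_Integral_Formula"
begin

text \<open>
  In both parts the orthonormal polynomials are shown to be explicit Chebyshev families
  f_n = (sum over i of g_i(y) U_(n-i)(x)) with coefficients g_i that do not depend on n.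
  Since 2 x f_n = f_(n+1) + f_(n-1), every such family contributes a row and a column 1/2 to A
  and 0 to B.

  For the density of (a) one takes g_i = h_i U_l, where l is at most m minus kappa.  For fixed y,
  orthogonality in x is the one-variable Bernstein-Szego theorem: on the unit circle the integrand
  is the imaginary part of an analytic function, to which the mean value property applies.

  For the density of (b), f_n(cos, cos) sin sin is the antisymmetrization of
  z^(n+1) w^(l+1) omega(1/z, 1/w) T(w/z), where T is the reversed Szego polynomial
  of degree at most m - l for the weight 1 / abs(omega)^2 on the circle.  Dividing by the density
  leaves z^(n+1) w^(l+1) T(u) / (omega(z, w) abs(omega(u))^2) with u = w/z; the substitution w = u z separates
  the analytic factor in z from the moments of T(u) / abs(omega(u))^2.
\<close>

text \<open>In (a) the coefficients h_i U_l reach y-degree \<kappa> + l, which fits only while l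
  \<le> m - \<kappa>. The last \<kappa> indices keep unknown entries, with no more than the shape
  that Gram-Schmidt forces in general. The density of (b) is again of the form 1 / abs(h)^2, with 2N
  for N and \<kappa> = N, so the gain to be made there is the last N indices. For these the degree m
  - l available to T is smaller than N and \<omega> itself is too long; a shorter T comes from a
  finite Toeplitz system. Its moments vanish only up to order m - l, which is exactly the range of
  negative powers of w that y^j with j \<le> m can create. After w = u z the total power of z may be
  negative, which blocks the mean value property. Powers of zw are then split off the analytic
  factor until the exponent is nonnegative; each constant that is split off integrates to 0. The
  lower bounds on n come from reflection: for i > n + 1 the term U_(n-i) is minus U_(i-n-2), and its
  degree must stay below the leading one, also at level n - 1.\<close>

hide_const (open) module.smult

section \<open>Orthonormal polynomials for a positive functional\<close>

text \<open>Elimination by a Schur complement, one index at a time. It serves twice: for the Gram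
  matrix of monomials and for the Toeplitz matrix of trigonometric moments.\<close>

lemma gram_system_solvable:
  fixes Q :: "'i \<Rightarrow> 'i \<Rightarrow> real"
  assumes "finite S"
    and "\<And>c. \<exists>i\<in>S. c i \<noteq> 0 \<Longrightarrow> (\<Sum>i\<in>S. \<Sum>j\<in>S. c i * c j * Q i j) > 0"
  shows "\<exists>c. \<forall>j\<in>S. (\<Sum>i\<in>S. c i * Q i j) = b j"
  using assms
proof (induction S arbitrary: b rule: finite_induct)
  case empty
  then show ?case by simp
next
  case (insert s S)
  note fin = insert.hyps(1) and sS = insert.hyps(2)
  have "(\<Sum>i\<in>S. \<Sum>j\<in>S. c i * c j * Q i j) > 0" if "\<exists>i\<in>S. c i \<noteq> 0" for c
  proof -
    define c' where "c' = c(s := 0)"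
    have ne: "\<exists>i\<in>insert s S. c' i \<noteq> 0"
      using that sS by (auto simp: c'_def)
    have eq: "c' i = c i" if "i \<in> S" for i
      using that sS by (auto simp: c'_def)
    have "(\<Sum>i\<in>insert s S. \<Sum>j\<in>insert s S. c' i * c' j * Q i j)
        = (\<Sum>i\<in>S. \<Sum>j\<in>S. c' i * c' j * Q i j)"
      using fin sS by (simp add: c'_def)
    also have "\<dots> = (\<Sum>i\<in>S. \<Sum>j\<in>S. c i * c j * Q i j)"
      by (intro sum.cong refl) (simp add: eq)
    finally show ?thesis
      using insert.prems[OF ne] by simp
  qed
  note IH = insert.IH[OF this]
  obtain cs where cs: "\<And>j. j \<in> S \<Longrightarrow> (\<Sum>i\<in>S. cs i * Q i j) = Q s j"
    using IH[of "Q s"] by auto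
  obtain cb where cb: "\<And>j. j \<in> S \<Longrightarrow> (\<Sum>i\<in>S. cb i * Q i j) = b j"
    using IH[of b] by auto
  \<comment> \<open>The unit vector at \<open>s\<close> minus its projection onto \<open>S\<close>.
    Its pairing with every \<open>j\<close> in \<open>S\<close> is 0, so its own form value reduces
    to the pairing with \<open>s\<close>, the Schur complement \<open>D\<close>.\<close>
  define e where "e i = (if i = s then 1 else - cs i)" for i
  have e_sum: "(\<Sum>i\<in>insert s S. e i * Q i j) = Q s j - (\<Sum>i\<in>S. cs i * Q i j)" for j
  proof -
    have "(\<Sum>i\<in>S. e i * Q i j) = (\<Sum>i\<in>S. - (cs i * Q i j))"
      using sS by (intro sum.cong) (auto simp: e_def)
    then show ?thesis
      using fin sS by (simp add: e_def sum_negf)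
  qed
  define D where "D = (\<Sum>i\<in>insert s S. e i * Q i s)"
  have "0 < (\<Sum>i\<in>insert s S. \<Sum>j\<in>insert s S. e i * e j * Q i j)"
    by (rule insert.prems) (simp add: e_def)
  also have "\<dots> = (\<Sum>j\<in>insert s S. e j * (\<Sum>i\<in>insert s S. e i * Q i j))"
    by (subst sum.swap) (simp only: sum_distrib_left mult_ac)
  also have "\<dots> = e s * D + (\<Sum>j\<in>S. e j * (\<Sum>i\<in>insert s S. e i * Q i j))"
    unfolding D_def by (rule sum.insert[OF fin sS])
  also have "(\<Sum>j\<in>S. e j * (\<Sum>i\<in>insert s S. e i * Q i j)) = 0"
    by (intro sum.neutral ballI) (simp only: e_sum cs, simp)
  finally have D: "D > 0"
    by (simp add: e_def)
  \<comment> \<open>Adding a multiple of \<open>e\<close> leaves the equations in \<open>S\<close>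
    intact; this multiple repairs the equation at \<open>s\<close>.\<close>
  define r where "r = (b s - (\<Sum>i\<in>S. cb i * Q i s)) / D"
  define c where "c i = (if i = s then 0 else cb i) + r * e i" for i
  have c_sum: "(\<Sum>i\<in>insert s S. c i * Q i j)
      = (\<Sum>i\<in>S. cb i * Q i j) + r * (\<Sum>i\<in>insert s S. e i * Q i j)" for j
  proof -
    have "(\<Sum>i\<in>insert s S. c i * Q i j) =
        (\<Sum>i\<in>insert s S. (if i = s then 0 else cb i) * Q i j) + r * (\<Sum>i\<in>insert s S. e i * Q i j)"
      by (simp only: c_def distrib_right sum.distrib sum_distrib_left mult.assoc)
    also have "(\<Sum>i\<in>insert s S. (if i = s then 0 else cb i) * Q i j) = (\<Sum>i\<in>S. cb i * Q i j)"
      using fin sS by (simp, intro sum.cong) auto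
    finally show ?thesis .
  qed
  have "(\<Sum>i\<in>insert s S. c i * Q i j) = b j" if "j \<in> insert s S" for j
  proof (cases "j = s")
    case True
    then have "(\<Sum>i\<in>insert s S. c i * Q i j) = (\<Sum>i\<in>S. cb i * Q i s) + r * D"
      by (simp only: c_sum D_def)
    then show ?thesis
      using True D by (simp add: r_def)
  next
    case False
    with that have "j \<in> S" by simp
    then show ?thesis
      unfolding c_sum e_sum by (simp only: cs cb, simp)
  qed
  then show ?case by blast
qed

section \<open>Supports of bivariate polynomials and lexicographic index sets\<close>

definition monom2 :: "nat \<Rightarrow> nat \<Rightarrow> real poly poly" where
  "monom2 i j = monom (monom 1 j) i"

definition supp_in :: "real poly poly \<Rightarrow> (nat \<times> nat) set \<Rightarrow> bool" where
  "supp_in p S \<longleftrightarrow> (\<forall>i j. coeff (coeff p i) j \<noteq> 0 \<longrightarrow> (i, j) \<in> S)"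

lemma coeff_monom2: "coeff (coeff (monom2 a b) i) j = (if i = a \<and> j = b then 1 else 0)"
  by (simp add: monom2_def)

lemma supp_in_mono: "supp_in p S \<Longrightarrow> S \<subseteq> T \<Longrightarrow> supp_in p T"
  by (auto simp: supp_in_def)

lemma supp_in_add: "supp_in p S \<Longrightarrow> supp_in q S \<Longrightarrow> supp_in (p + q) S"
  unfolding supp_in_def by (metis add_0 coeff_add)

lemma supp_in_smult: "supp_in p S \<Longrightarrow> supp_in (smult [:c:] p) S"
  by (simp add: supp_in_def)

lemma supp_in_sum: "(\<And>a. a \<in> A \<Longrightarrow> supp_in (f a) S) \<Longrightarrow> supp_in (sum f A) S"
  by (induction A rule: infinite_finite_induct) (auto simp: supp_in_add supp_in_def[of 0])

lemma supp_in_monom2: "(i, j) \<in> S \<Longrightarrow> supp_in (monom2 i j) S"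
  by (simp add: supp_in_def coeff_monom2)

lemma supp_in_expand:
  assumes "finite S" "supp_in p S"
  shows "p = (\<Sum>(i, j)\<in>S. smult [:coeff (coeff p i) j:] (monom2 i j))"
proof (intro poly_eqI)
  fix a b
  have "coeff (coeff (\<Sum>(i, j)\<in>S. smult [:coeff (coeff p i) j:] (monom2 i j)) a) b
      = (\<Sum>x\<in>S. if x = (a, b) then coeff (coeff p a) b else 0)"
    by (simp add: coeff_sum case_prod_beta coeff_monom2)
       (intro sum.cong refl, auto)
  also have "\<dots> = coeff (coeff p a) b"
    using assms by (auto simp: supp_in_def)
  finally show "coeff (coeff p a) b =
    coeff (coeff (\<Sum>(i, j)\<in>S. smult [:coeff (coeff p i) j:] (monom2 i j)) a) b" by simp
qed

definition lex_le :: "nat \<Rightarrow> nat \<Rightarrow> nat \<Rightarrow> (nat \<times> nat) set" where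
  "lex_le n m l = {(i, j). j \<le> m \<and> (i < n \<or> (i = n \<and> j \<le> l))}"

definition lex_less :: "nat \<Rightarrow> nat \<Rightarrow> nat \<Rightarrow> (nat \<times> nat) set" where
  "lex_less n m l = {(i, j). (i < n \<and> j \<le> m) \<or> (i = n \<and> j < l)}"

lemma finite_lex_le: "finite (lex_le n m l)"
  by (rule finite_subset[of _ "{..n} \<times> {..m}"]) (auto simp: lex_le_def)

lemma finite_lex_less: "finite (lex_less n m l)"
  by (rule finite_subset[of _ "{..n} \<times> {..m + l}"]) (auto simp: lex_less_def)

lemma lex_le_eq: "l \<le> m \<Longrightarrow> lex_le n m l = insert (n, l) (lex_less n m l)"
  by (auto simp: lex_le_def lex_less_def)

lemma lex_less_not: "(n, l) \<notin> lex_less n m l"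
  by (auto simp: lex_less_def)

text \<open>Integration enters only through linearity and positivity on squares, so orthonormal
  polynomials and the triangular shape of A become linear algebra. A real scalar appears as
  \<open>smult [:c:]\<close> because the coefficients of the outer polynomial are polynomials in
  y.\<close>

locale pos_functional =
  fixes L :: "real poly poly \<Rightarrow> real"
  assumes L_add: "L (p + q) = L p + L q"
    and L_smult: "L (smult [:c:] p) = c * L p"
    and L_pos: "p \<noteq> 0 \<Longrightarrow> L (p * p) > 0"
begin

lemma L_zero: "L 0 = 0"
  using L_smult[of 0 0] by simp

lemma L_diff: "L (p - q) = L p - L q"
  using L_add[of "p - q" q] by simp

lemma L_sum: "L (sum f A) = (\<Sum>a\<in>A. L (f a))"
  by (induction A rule: infinite_finite_induct) (simp_all add: L_add L_zero)

definition onp :: "nat \<Rightarrow> nat \<Rightarrow> nat \<Rightarrow> real poly poly \<Rightarrow> bool" where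
  "onp n m l p \<longleftrightarrow> supp_in p (lex_le n m l) \<and> coeff (coeff p n) l > 0 \<and> L (p * p) = 1 \<and>
     (\<forall>i j. (i, j) \<in> lex_less n m l \<longrightarrow> L (p * monom2 i j) = 0)"

lemma L_mult_expand:
  assumes "finite S" "supp_in q S"
  shows "L (p * q) = (\<Sum>(i, j)\<in>S. coeff (coeff q i) j * L (p * monom2 i j))"
  by (subst supp_in_expand[OF assms])
     (simp add: sum_distrib_left L_sum case_prod_beta mult_smult_right L_smult)

lemma onp_orth:
  assumes "onp n m l p" "supp_in q (lex_less n m l)"
  shows "L (p * q) = 0"
  unfolding L_mult_expand[OF finite_lex_less assms(2)]
  using assms(1) by (intro sum.neutral) (auto simp: onp_def)

text \<open>All monomials of \<open>q\<close> below the leading one are killed, so the pairing sees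
  nothing of \<open>q\<close> but its leading coefficient.\<close>

lemma L_mult_lead:
  assumes orth: "\<And>i j. (i, j) \<in> lex_less n m l \<Longrightarrow> L (p * monom2 i j) = 0"
    and "supp_in q (lex_le n m l)" "l \<le> m"
  shows "L (p * q) = coeff (coeff q n) l * L (p * monom2 n l)"
proof -
  have "L (p * q) = (\<Sum>(i, j)\<in>lex_le n m l. coeff (coeff q i) j * L (p * monom2 i j))"
    by (rule L_mult_expand[OF finite_lex_le assms(2)])
  also have "\<dots> = coeff (coeff q n) l * L (p * monom2 n l)
      + (\<Sum>(i, j)\<in>lex_less n m l. coeff (coeff q i) j * L (p * monom2 i j))"
    by (simp add: lex_le_eq[OF assms(3)] finite_lex_less lex_less_not)
  also have "(\<Sum>(i, j)\<in>lex_less n m l. coeff (coeff q i) j * L (p * monom2 i j)) = 0"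
    by (intro sum.neutral) (auto simp: orth)
  finally show ?thesis by simp
qed

text \<open>The case \<open>q = p\<close>, where the pairing is 1, shows that \<open>p\<close>
  paired with its leading monomial is the reciprocal of its leading coefficient.\<close>

lemma onp_inner:
  assumes p: "onp n m l p" and q: "supp_in q (lex_le n m l)" and "l \<le> m"
  shows "L (p * q) = coeff (coeff q n) l / coeff (coeff p n) l"
proof -
  have "1 = coeff (coeff p n) l * L (p * monom2 n l)"
    using L_mult_lead[of n m l p p] p \<open>l \<le> m\<close> by (simp add: onp_def)
  moreover have "coeff (coeff p n) l > 0"
    using p by (simp add: onp_def)
  ultimately have "L (p * monom2 n l) = 1 / coeff (coeff p n) l"
    by (simp add: field_simps)
  then show ?thesis
    using L_mult_lead[of n m l p q] p q \<open>l \<le> m\<close> by (simp add: onp_def)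
qed

text \<open>Pairing \<open>p\<close> with \<open>q\<close> in both orders gives two reciprocal
  ratios of leading coefficients. They agree by symmetry and are positive, hence equal 1, and then
  \<open>p - q\<close> has norm 0.\<close>

lemma onp_unique:
  assumes p: "onp n m l p" and q: "onp n m l q" and "l \<le> m"
  shows "p = q"
proof -
  let ?a = "coeff (coeff p n) l" and ?b = "coeff (coeff q n) l"
  have "?a > 0" "?b > 0"
    using p q by (auto simp: onp_def)
  have "L (p * q) = ?b / ?a" "L (q * p) = ?a / ?b"
    using onp_inner[OF p _ \<open>l \<le> m\<close>, of q] onp_inner[OF q _ \<open>l \<le> m\<close>, of p] p q
    by (auto simp: onp_def)
  then have "?a / ?b = ?b / ?a" "L (q * p) = ?a / ?b"
    by (simp_all add: mult.commute)
  then have pq: "L (q * p) = 1"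
    using \<open>?a > 0\<close> \<open>?b > 0\<close> by (simp add: field_simps power2_eq_square[symmetric] power2_eq_iff)
  have "(p - q) * (p - q) = p * p - q * p - (q * p - q * q)"
    by (simp add: algebra_simps)
  then have "L ((p - q) * (p - q)) = 0"
    using p q pq by (simp only: L_diff onp_def)
  then show ?thesis
    using L_pos[of "p - q"] by fastforce
qed

text \<open>The dual vector of the leading monomial: the Gram system is solved with the indicator of
  \<open>(n, l)\<close> on the right. The leading coefficient of this solution equals its squared
  norm, so it is positive and its root normalises the solution.\<close>

lemma onp_exists:
  assumes "l \<le> m"
  shows "\<exists>p. onp n m l p"
proof -
  let ?S = "lex_le n m l"
  have fin: "finite ?S" by (rule finite_lex_le)
  define Q where "Q = (\<lambda>(i, j) (k, r). L (monom2 i j * monom2 k r))"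
  define P where "P c = (\<Sum>(i, j)\<in>?S. smult [:c (i, j):] (monom2 i j))" for c :: "nat \<times> nat \<Rightarrow> real"
  have suppP: "supp_in (P c) ?S" for c
    unfolding P_def by (rule supp_in_sum) (auto intro!: supp_in_smult supp_in_monom2)
  have coeffP: "coeff (coeff (P c) i) j = c (i, j)" if "(i, j) \<in> ?S" for c i j
  proof -
    have "coeff (coeff (P c) i) j = (\<Sum>x\<in>?S. if x = (i, j) then c (i, j) else 0)"
      by (simp add: P_def coeff_sum case_prod_beta coeff_monom2) (intro sum.cong refl, auto)
    then show ?thesis using that fin by simp
  qed
  have LP: "L (P c * monom2 k r) = (\<Sum>s\<in>?S. c s * Q s (k, r))" for c k r
    by (simp add: P_def sum_distrib_right L_sum case_prod_beta L_smult Q_def)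
  have "(\<Sum>i\<in>?S. \<Sum>j\<in>?S. c i * c j * Q i j) > 0" if "\<exists>i\<in>?S. c i \<noteq> 0" for c
  proof -
    have "P c \<noteq> 0"
      using that coeffP[of _ _ c] by fastforce
    then have "0 < L (P c * P c)" by (rule L_pos)
    also have "\<dots> = (\<Sum>(k, r)\<in>?S. c (k, r) * L (P c * monom2 k r))"
      unfolding L_mult_expand[OF fin suppP] by (intro sum.cong) (auto simp: coeffP)
    also have "\<dots> = (\<Sum>j\<in>?S. \<Sum>i\<in>?S. c i * c j * Q i j)"
      by (intro sum.cong) (auto simp: LP sum_distrib_left mult_ac)
    finally show ?thesis by (subst sum.swap)
  qed
  then obtain c where c: "\<And>j. j \<in> ?S \<Longrightarrow> (\<Sum>i\<in>?S. c i * Q i j) = (if j = (n, l) then 1 else 0)"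
    using gram_system_solvable[OF fin, of Q "\<lambda>j. if j = (n, l) then 1 else 0"] by auto
  have orth: "L (P c * monom2 i j) = (if (i, j) = (n, l) then 1 else 0)" if "(i, j) \<in> ?S" for i j
    using c[OF that] by (simp add: LP)
  have nl: "(n, l) \<in> ?S"
    by (simp add: lex_le_eq[OF assms])
  have LPP: "L (P c * P c) = c (n, l)"
  proof -
    have "L (P c * P c) = (\<Sum>(i, j)\<in>?S. coeff (coeff (P c) i) j * L (P c * monom2 i j))"
      by (rule L_mult_expand[OF fin suppP])
    also have "\<dots> = (\<Sum>s\<in>?S. if s = (n, l) then c s else 0)"
      by (intro sum.cong) (auto simp: coeffP orth split: if_splits)
    also have "\<dots> = c (n, l)"
      using nl fin by simp
    finally show ?thesis .
  qed
  have "P c \<noteq> 0"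
    using orth[OF nl] by (auto simp: L_zero)
  then have pos: "c (n, l) > 0"
    using L_pos LPP by metis
  let ?r = "1 / sqrt (c (n, l))"
  have "onp n m l (smult [:?r:] (P c))"
    unfolding onp_def
  proof (intro conjI allI impI)
    show "supp_in (smult [:?r:] (P c)) ?S"
      by (rule supp_in_smult[OF suppP])
    show "0 < coeff (coeff (smult [:?r:] (P c)) n) l"
      using pos by (simp add: coeffP[OF nl])
    show "L (smult [:?r:] (P c) * smult [:?r:] (P c)) = 1"
      using pos by (simp only: mult_smult_left mult_smult_right L_smult LPP) (simp add: real_div_sqrt)
    fix i j assume "(i, j) \<in> lex_less n m l"
    then have "(i, j) \<in> ?S" "(i, j) \<noteq> (n, l)"
      using lex_le_eq[OF assms] lex_less_not by auto
    then show "L (smult [:?r:] (P c) * monom2 i j) = 0"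
      by (auto simp: L_smult orth)
  qed
  then show ?thesis by blast
qed

definition the_onp :: "nat \<Rightarrow> nat \<Rightarrow> nat \<Rightarrow> real poly poly" where
  "the_onp n m l = (THE p. onp n m l p)"

lemma the_onp_eq: "onp n m l p \<Longrightarrow> l \<le> m \<Longrightarrow> the_onp n m l = p"
  unfolding the_onp_def by (rule the_equality) (auto intro: onp_unique)

lemma the_onp: "l \<le> m \<Longrightarrow> onp n m l (the_onp n m l)"
  using onp_exists the_onp_eq by metis

lemma onp_supp: "onp n m l p \<Longrightarrow> supp_in p (lex_le n m l)"
  by (simp add: onp_def)

lemma onp_lead_pos: "onp n m l p \<Longrightarrow> coeff (coeff p n) l > 0"
  by (simp add: onp_def)

lemma supp_lex_lt: "supp_in p (lex_le k m r) \<Longrightarrow> k < n \<Longrightarrow> supp_in p (lex_less n m l)"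
  by (erule supp_in_mono) (auto simp: lex_le_def lex_less_def)

lemma onp_orthonormal:
  assumes "onp n m k p" "onp n m l q" "k \<le> m" "l \<le> m"
  shows "L (p * q) = (if k = l then 1 else 0)"
proof (cases k l rule: linorder_cases)
  case less
  then have "supp_in p (lex_less n m l)"
    using onp_supp[OF assms(1)] \<open>l \<le> m\<close>
    by (elim supp_in_mono) (auto simp: lex_le_def lex_less_def)
  then show ?thesis
    using onp_orth[OF assms(2), of p] less by (simp add: mult.commute)
next
  case greater
  then have "supp_in q (lex_less n m k)"
    using onp_supp[OF assms(2)] \<open>k \<le> m\<close>
    by (elim supp_in_mono) (auto simp: lex_le_def lex_less_def)
  then show ?thesis
    using onp_orth[OF assms(1), of q] greater by simp
next
  case equal
  then have "p = q" using assms onp_unique by blast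
  then show ?thesis using equal assms by (simp add: onp_def)
qed

section \<open>Recurrence coefficients for an abstract positive functional\<close>

abbreviation X :: "real poly poly" where "X \<equiv> [:0, 1:]"

definition A_entry :: "nat \<Rightarrow> nat \<Rightarrow> nat \<Rightarrow> nat \<Rightarrow> real" where
  "A_entry n m k l = L (X * the_onp (n - 1) m k * the_onp n m l)"

definition B_entry :: "nat \<Rightarrow> nat \<Rightarrow> nat \<Rightarrow> nat \<Rightarrow> real" where
  "B_entry n m k l = L (X * the_onp n m k * the_onp n m l)"

lemma supp_in_X_mult: "supp_in p (lex_le (n - 1) m k) \<Longrightarrow> n \<ge> 1 \<Longrightarrow> supp_in (X * p) (lex_le n m k)"
  by (fastforce simp: supp_in_def lex_le_def coeff_pCons split: nat.splits)

text \<open>For \<open>k \<le> l\<close> the product of x with the k-th polynomial still lies in the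
  span that belongs to \<open>l\<close>, so the entry is a ratio of leading coefficients.
  Triangularity and the positive diagonal of the block C follow from this alone.\<close>

lemma A_entry_lower:
  assumes "n \<ge> 1" "k \<le> l" "l \<le> m"
  shows "A_entry n m k l = (if k = l
    then coeff (coeff (the_onp (n - 1) m l) (n - 1)) l / coeff (coeff (the_onp n m l) n) l else 0)"
proof -
  have k: "k \<le> m" using assms by simp
  let ?p = "the_onp (n - 1) m k" and ?q = "the_onp n m l"
  have supp_p: "supp_in ?p (lex_le (n - 1) m k)"
    by (rule onp_supp[OF the_onp[OF k]])
  have "supp_in (X * ?p) (lex_le n m k)"
    using supp_p assms(1) by (rule supp_in_X_mult)
  then have "supp_in (X * ?p) (lex_le n m l)"
    by (rule supp_in_mono) (use assms in \<open>auto simp: lex_le_def\<close>)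
  then have "L (?q * (X * ?p)) = coeff (coeff (X * ?p) n) l / coeff (coeff ?q n) l"
    using onp_inner[OF the_onp[OF \<open>l \<le> m\<close>] _ \<open>l \<le> m\<close>] by blast
  moreover have "coeff (coeff (X * ?p) n) l = coeff (coeff ?p (n - 1)) l"
    using assms(1) by (cases n) auto
  moreover have "coeff (coeff ?p (n - 1)) l = 0" if "k \<noteq> l"
    using supp_p that assms unfolding supp_in_def lex_le_def by fastforce
  ultimately show ?thesis
    by (auto simp: A_entry_def mult.commute)
qed

lemma A_entry_upper_zero: "n \<ge> 1 \<Longrightarrow> k < l \<Longrightarrow> l \<le> m \<Longrightarrow> A_entry n m k l = 0"
  using A_entry_lower[of n k l m] by simp

lemma A_entry_diag_pos: "n \<ge> 1 \<Longrightarrow> l \<le> m \<Longrightarrow> A_entry n m l l > 0"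
  using A_entry_lower[of n l l m] onp_lead_pos[OF the_onp, of l m] by simp

lemma B_entry_sym: "B_entry n m k l = B_entry n m l k"
  by (simp add: B_entry_def mult_ac)

text \<open>Only the polynomials with index \<open>l\<close> are known; those with index
  \<open>k\<close> are arbitrary. The factor x is moved to the known one and split by the
  recurrence: \<open>r1\<close> serves column \<open>l\<close> of A and all of B, while row
  \<open>l\<close> of A involves level \<open>n - 1\<close> and needs \<open>r0\<close>. Of
  \<open>fm\<close> only the low x-degree matters, not its orthogonality.\<close>

lemma entries_of_chebyshev_recurrence:
  assumes f0: "onp (n - 1) m l f0" and f1: "onp n m l f1" and f2: "onp (n + 1) m l f2"
    and fm: "supp_in fm (lex_less n m 0)"
    and r1: "smult 2 (X * f1) = f2 + f0" and r0: "smult 2 (X * f0) = f1 + fm"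
    and n: "n \<ge> 1" and k: "k \<le> m" and l: "l \<le> m"
  shows "A_entry n m k l = (if k = l then 1 / 2 else 0)"
    and "A_entry n m l k = (if k = l then 1 / 2 else 0)"
    and "B_entry n m k l = 0"
    and "B_entry n m l k = 0"
proof -
  have two: "2 * L (X * p * q) = L (smult 2 (X * q) * p)" for p q
    using L_smult[of 2 "X * p * q"] by (simp add: mult_ac numeral_poly)
  have f: "the_onp (n - 1) m l = f0" "the_onp n m l = f1"
    using the_onp_eq f0 f1 l by auto
  let ?p = "the_onp (n - 1) m k" and ?q = "the_onp n m k"
  have p: "onp (n - 1) m k ?p" and q: "onp n m k ?q"
    using the_onp k by auto
  have "2 * A_entry n m k l = L (f2 * ?p) + L (f0 * ?p)"
    unfolding A_entry_def f two r1 by (simp add: algebra_simps L_add)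
  also have "L (f2 * ?p) = 0"
    by (rule onp_orth[OF f2], rule supp_lex_lt[OF onp_supp[OF p]]) simp
  also have "L (f0 * ?p) = (if l = k then 1 else 0)"
    by (rule onp_orthonormal[OF f0 p l k])
  finally show "A_entry n m k l = (if k = l then 1 / 2 else 0)"
    by auto
  have "2 * A_entry n m l k = 2 * L (X * ?q * f0)"
    by (simp only: A_entry_def f mult_ac)
  also have "\<dots> = L (f1 * ?q) + L (?q * fm)"
    unfolding two r0 by (simp add: algebra_simps L_add)
  also have "L (?q * fm) = 0"
    by (rule onp_orth[OF q], rule supp_in_mono[OF fm]) (auto simp: lex_less_def)
  also have "L (f1 * ?q) = (if l = k then 1 else 0)"
    by (rule onp_orthonormal[OF f1 q l k])
  finally show "A_entry n m l k = (if k = l then 1 / 2 else 0)"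
    by auto
  have "2 * B_entry n m k l = L (f2 * ?q) + L (?q * f0)"
    unfolding B_entry_def f two r1 by (simp add: algebra_simps L_add)
  also have "L (f2 * ?q) = 0"
    by (rule onp_orth[OF f2], rule supp_lex_lt[OF onp_supp[OF q]]) simp
  also have "L (?q * f0) = 0"
    by (rule onp_orth[OF q], rule supp_lex_lt[OF onp_supp[OF f0]]) (use n in simp)
  finally show "B_entry n m k l = 0"
    by simp
  then show "B_entry n m l k = 0"
    by (simp add: B_entry_sym)
qed

end

section \<open>Chebyshev families\<close>

text \<open>cheb n is the Chebyshev polynomial of the second kind of degree n - 1, and ucheb extends it to
  all integers as an odd function of the index.\<close>

fun cheb :: "nat \<Rightarrow> 'a::comm_ring_1 poly" where
  "cheb 0 = 0"
| "cheb (Suc 0) = 1"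
| "cheb (Suc (Suc n)) = smult 2 (pCons 0 (cheb (Suc n))) - cheb n"

definition ucheb :: "int \<Rightarrow> 'a::comm_ring_1 poly" where
  "ucheb a = (if a \<ge> 0 then cheb (nat a) else - cheb (nat (- a)))"

text \<open>The odd extension carries the three-term recurrence through index 0, so sums over
  shifted indices obey it without boundary terms.\<close>

lemma ucheb_rec: "smult 2 (pCons 0 (ucheb a)) = ucheb (a + 1) + (ucheb (a - 1) :: 'a::comm_ring_1 poly)"
proof -
  have rec: "smult 2 (pCons 0 (ucheb (int (Suc n)))) = ucheb (int (Suc n) + 1) + (ucheb (int (Suc n) - 1) :: 'a poly)" for n
    by (simp add: ucheb_def nat_add_distrib eval_nat_numeral)
  have odd: "ucheb (- b) = - (ucheb b :: 'a poly)" for b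
    by (simp add: ucheb_def)
  have minus: "smult 2 (pCons 0 (- q)) = - smult 2 (pCons 0 q)" for q :: "'a poly"
    by simp
  show ?thesis
  proof (cases a rule: int_cases3)
    case zero
    then show ?thesis by (simp add: ucheb_def)
  next
    case (pos k)
    then show ?thesis using rec[of "k - 1"] by simp
  next
    case (neg n)
    then obtain k where k: "a = - int (Suc k)" by (metis Suc_pred)
    have *: "a + 1 = - (int (Suc k) - 1)" "a - 1 = - (int (Suc k) + 1)"
      using k by auto
    show ?thesis
      unfolding * unfolding k odd minus rec by (simp add: algebra_simps)
  qed
qed

lemma coeff_cheb_eq_0: "i \<ge> n \<Longrightarrow> coeff (cheb n) i = 0"
  by (induction n arbitrary: i rule: cheb.induct) (auto simp: coeff_pCons split: nat.splits)

lemma coeff_cheb_lead: "coeff (cheb (Suc n)) n = 2 ^ n"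
proof (induction n)
  case (Suc n)
  then show ?case by (simp add: coeff_cheb_eq_0)
qed simp

text \<open>\<open>cheb\<close> occurs as a polynomial in y and, at type
  \<open>real poly poly\<close>, as one in x. In the second role its coefficients are constants, so
  a factor \<open>g\<close> in y keeps its degree.\<close>

lemma coeff_coeff_cheb: "j > 0 \<Longrightarrow> coeff (coeff (cheb n :: 'a::comm_ring_1 poly poly) i) j = 0"
proof (induction n arbitrary: i rule: cheb.induct)
  case 2
  then show ?case by (cases i) auto
next
  case (3 n)
  have "coeff (2 * p) j = 2 * coeff p j" for p :: "'a poly"
    using coeff_smult[of 2 p j] by (simp add: numeral_poly)
  then show ?case using 3 by (auto simp: coeff_pCons split: nat.splits)
qed auto

lemma poly_poly_cheb: "poly (poly (cheb n) [:x:]) y = poly (cheb n) x"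
  by (induction n rule: cheb.induct) auto

lemma poly_poly_ucheb: "poly (poly (ucheb a) [:x:]) y = poly (ucheb a) x"
  by (simp add: ucheb_def poly_poly_cheb)

lemma cheb_cos: "poly (cheb n) (cos (\<theta> :: real)) * sin \<theta> = sin (real n * \<theta>)"
proof (induction n rule: cheb.induct)
  case (3 n)
  have "sin (real (Suc n) * \<theta> + \<theta>) + sin (real (Suc n) * \<theta> - \<theta>) = 2 * cos \<theta> * sin (real (Suc n) * \<theta>)"
    by (simp add: sin_add sin_diff)
  then have "sin (real (Suc (Suc n)) * \<theta>) = 2 * cos \<theta> * sin (real (Suc n) * \<theta>) - sin (real n * \<theta>)"
    by (simp add: algebra_simps)
  then show ?case
    using 3 by (simp add: algebra_simps)
qed auto

lemma ucheb_cos: "poly (ucheb a) (cos (\<theta> :: real)) * sin \<theta> = sin (of_int a * \<theta>)"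
proof (cases "a \<ge> 0")
  case True
  then show ?thesis using cheb_cos[of "nat a" \<theta>] by (simp add: ucheb_def)
next
  case False
  then show ?thesis using cheb_cos[of "nat (- a)" \<theta>] by (simp add: ucheb_def)
qed

lemma coeff_ucheb_eq_0: "\<bar>a\<bar> \<le> int i \<Longrightarrow> coeff (ucheb a) i = 0"
  by (simp add: ucheb_def coeff_cheb_eq_0)

lemma degree_ucheb_le:
  assumes "\<bar>a\<bar> \<le> int n + 1"
  shows "degree (ucheb a) \<le> n"
  using assms by (intro degree_le) (auto intro!: coeff_ucheb_eq_0)

lemma coeff_ucheb_lead: "coeff (ucheb (int n + 1)) n = 2 ^ n"
  using coeff_cheb_lead[of n] by (simp add: ucheb_def nat_add_distrib)

lemma coeff_coeff_ucheb: "j > 0 \<Longrightarrow> coeff (coeff (ucheb a :: 'a::comm_ring_1 poly poly) i) j = 0"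
  by (simp add: ucheb_def coeff_coeff_cheb)

text \<open>The f_n of the overview is the case \<open>a = int n + 1\<close>, since
  \<open>ucheb\<close> is indexed by degree plus one. The index is an integer because the shifts may
  become negative.\<close>

definition cheb_family :: "(nat \<Rightarrow> real poly) \<Rightarrow> nat \<Rightarrow> int \<Rightarrow> real poly poly" where
  "cheb_family g K a = (\<Sum>i\<le>K. smult (g i) (ucheb (a - int i)))"

lemma eval2_cheb_family:
  "eval2 (cheb_family g K a) x y = (\<Sum>i\<le>K. poly (g i) y * poly (ucheb (a - int i)) x)"
  by (simp add: eval2_def cheb_family_def poly_sum poly_poly_ucheb)

lemma smult_sum_right: "smult c (sum f A) = (\<Sum>a\<in>A. smult c (f a))"
  by (induction A rule: infinite_finite_induct) (simp_all add: smult_add_right)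

lemma cheb_family_rec:
  "smult 2 ([:0, 1:] * cheb_family g K a) = cheb_family g K (a + 1) + cheb_family g K (a - 1)"
proof -
  have "smult 2 ([:0, 1:] * cheb_family g K a)
      = (\<Sum>i\<le>K. smult (g i) (smult 2 (pCons 0 (ucheb (a - int i)))))"
    by (simp only: cheb_family_def sum_distrib_left smult_sum_right) (simp add: mult_ac)
  also have "\<dots> = (\<Sum>i\<le>K. smult (g i) (ucheb (a - int i + 1) + ucheb (a - int i - 1)))"
    by (simp only: ucheb_rec)
  finally show ?thesis
    by (simp add: cheb_family_def smult_add_right sum.distrib algebra_simps)
qed

lemma supp_in_ucheb:
  assumes "\<bar>a\<bar> \<le> int n" "degree g \<le> m"
  shows "supp_in (smult g (ucheb a)) (lex_less n m 0)"
  unfolding supp_in_def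
proof (intro allI impI)
  fix i j assume nz: "coeff (coeff (smult g (ucheb a)) i) j \<noteq> 0"
  then have "coeff (ucheb a :: real poly poly) i \<noteq> 0"
    by auto
  then have "i < n"
    using coeff_ucheb_eq_0[of a i] assms(1) by fastforce
  have "degree (coeff (ucheb a :: real poly poly) i) = 0"
    using coeff_coeff_ucheb by (intro antisym degree_le) auto
  then have "degree (g * coeff (ucheb a) i) \<le> m"
    using degree_mult_le[of g "coeff (ucheb a) i"] assms(2) by simp
  then have "j \<le> m"
    using nz le_degree[of "g * coeff (ucheb a) i" j] by simp
  with \<open>i < n\<close> show "(i, j) \<in> lex_less n m 0"
    by (simp add: lex_less_def)
qed

lemma supp_in_cheb_family_less:
  assumes "\<And>i. i \<le> K \<Longrightarrow> degree (g i) \<le> m" "\<And>i. i \<le> K \<Longrightarrow> \<bar>a - int i\<bar> \<le> int n"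
  shows "supp_in (cheb_family g K a) (lex_less n m 0)"
  unfolding cheb_family_def using assms by (intro supp_in_sum supp_in_ucheb) auto

lemma coeff_ucheb_lead2: "coeff (coeff (smult (g :: real poly) (ucheb (int n + 1))) n) j = 2 ^ n * coeff g j"
proof -
  have "coeff (ucheb (int n + 1) :: real poly poly) n = [:2 ^ n:]"
    by (simp add: coeff_ucheb_lead numeral_poly poly_const_pow)
  then show ?thesis by simp
qed

text \<open>\<open>K < 2 * n + 2\<close> keeps the indices \<open>n + 1 - i\<close> with
  \<open>1 \<le> i \<le> K\<close> between \<open>- n\<close> and \<open>n\<close>. These terms have
  x-degree below \<open>n\<close>, so \<open>g 0\<close> alone determines the leading row.\<close>

lemma cheb_family_lead:
  assumes "\<And>i. i \<le> K \<Longrightarrow> degree (g i) \<le> m" "K < 2 * n + 2" "degree (g 0) \<le> l" "l \<le> m"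
  shows "supp_in (cheb_family g K (int n + 1)) (lex_le n m l)"
    and "coeff (coeff (cheb_family g K (int n + 1)) n) l = 2 ^ n * coeff (g 0) l"
proof -
  define rest where "rest = (\<Sum>i=1..K. smult (g i) (ucheb (int n + 1 - int i)))"
  have split: "cheb_family g K (int n + 1) = smult (g 0) (ucheb (int n + 1)) + rest"
    unfolding cheb_family_def rest_def atMost_atLeast0
    by (subst sum.atLeast_Suc_atMost) auto
  have rest: "supp_in rest (lex_less n m 0)"
    unfolding rest_def using assms by (intro supp_in_sum supp_in_ucheb) auto
  have head: "supp_in (smult (g 0) (ucheb (int n + 1))) (lex_le n m l)"
    unfolding supp_in_def
  proof (intro allI impI)
    fix i j assume nz: "coeff (coeff (smult (g 0) (ucheb (int n + 1))) i) j \<noteq> 0"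
    have "supp_in (smult (g 0) (ucheb (int n + 1))) (lex_less (n + 1) m 0)"
      using assms by (intro supp_in_ucheb) auto
    with nz have "(i, j) \<in> lex_less (n + 1) m 0"
      unfolding supp_in_def by blast
    then have "i \<le> n" "j \<le> m"
      by (auto simp: lex_less_def)
    moreover have "j \<le> l" if "i = n"
      using nz coeff_ucheb_lead2[of "g 0" n j] le_degree[of "g 0" j] assms(3) that by fastforce
    ultimately show "(i, j) \<in> lex_le n m l"
      by (auto simp: lex_le_def)
  qed
  show "supp_in (cheb_family g K (int n + 1)) (lex_le n m l)"
    unfolding split by (intro supp_in_add head supp_in_mono[OF rest]) (auto simp: lex_less_def lex_le_def)
  have "coeff (coeff rest n) l = 0"
    using rest by (auto simp: supp_in_def lex_less_def)
  then show "coeff (coeff (cheb_family g K (int n + 1)) n) l = 2 ^ n * coeff (g 0) l"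
    unfolding split by (simp only: coeff_add coeff_ucheb_lead2)
qed

context pos_functional
begin

lemma onp_cheb_family:
  assumes "\<And>i. i \<le> K \<Longrightarrow> degree (g i) \<le> m" "K < 2 * n + 2" "degree (g 0) \<le> l" "l \<le> m"
    and "coeff (g 0) l > 0"
    and orth: "\<And>i j. (i, j) \<in> lex_less n m l \<Longrightarrow> L (cheb_family g K (int n + 1) * monom2 i j) = 0"
    and norm: "2 ^ n * coeff (g 0) l * L (cheb_family g K (int n + 1) * monom2 n l) = 1"
  shows "onp n m l (cheb_family g K (int n + 1))"
proof -
  note lead = cheb_family_lead[where g = g and K = K and m = m and n = n and l = l, OF assms(1-4)]
  show ?thesis
    unfolding onp_def using lead assms(5) orth norm L_mult_lead[OF orth lead(1) \<open>l \<le> m\<close>]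
    by auto
qed

text \<open>Orthonormality is used at the levels \<open>n - 1\<close>, \<open>n\<close> and
  \<open>n + 1\<close>, which \<open>n \<le> \<nu> + 1\<close> covers without truncated subtraction.
  The bound \<open>K < 2 * n\<close> is the leading-term condition at level \<open>n - 1\<close>; it
  also keeps the family with index \<open>n - 1\<close> below x-degree \<open>n\<close>.\<close>

lemma entries_of_cheb_family:
  assumes "\<And>i. i \<le> K \<Longrightarrow> degree (g i) \<le> m" "K < 2 * n" "degree (g 0) \<le> l" "l \<le> m"
    and "coeff (g 0) l > 0"
    and orth: "\<And>\<nu> i j. n \<le> \<nu> + 1 \<Longrightarrow> (i, j) \<in> lex_less \<nu> m l \<Longrightarrow>
        L (cheb_family g K (int \<nu> + 1) * monom2 i j) = 0"
    and norm: "\<And>\<nu>. n \<le> \<nu> + 1 \<Longrightarrow> 2 ^ \<nu> * coeff (g 0) l * L (cheb_family g K (int \<nu> + 1) * monom2 \<nu> l) = 1"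
    and k: "k \<le> m"
  shows "A_entry n m k l = (if k = l then 1 / 2 else 0)"
    and "A_entry n m l k = (if k = l then 1 / 2 else 0)"
    and "B_entry n m k l = 0"
    and "B_entry n m l k = 0"
proof -
  have n: "n \<ge> 1" using assms(2) by simp
  have onp: "onp \<nu> m l (cheb_family g K (int \<nu> + 1))" if "n \<le> \<nu> + 1" for \<nu>
    using that assms(2) by (intro onp_cheb_family assms) auto
  have n1: "int (n - 1) + 1 = int n" "int (n + 1) + 1 = int n + 1 + 1"
    using n by auto
  have f0: "onp (n - 1) m l (cheb_family g K (int n))"
    using onp[of "n - 1"] n unfolding n1 by simp
  have f1: "onp n m l (cheb_family g K (int n + 1))"
    using onp[of n] by simp
  have f2: "onp (n + 1) m l (cheb_family g K (int n + 1 + 1))"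
    using onp[of "n + 1"] unfolding n1 by simp
  have fm: "supp_in (cheb_family g K (int n - 1)) (lex_less n m 0)"
    using assms(1,2) by (intro supp_in_cheb_family_less) auto
  have r1: "smult 2 (X * cheb_family g K (int n + 1)) = cheb_family g K (int n + 1 + 1) + cheb_family g K (int n)"
    using cheb_family_rec[of g K "int n + 1"] by simp
  note r0 = cheb_family_rec[of g K "int n"]
  note e = entries_of_chebyshev_recurrence[OF f0 f1 f2 fm r1 r0 n k \<open>l \<le> m\<close>]
  show "A_entry n m k l = (if k = l then 1 / 2 else 0)"
    and "A_entry n m l k = (if k = l then 1 / 2 else 0)"
    and "B_entry n m k l = 0" and "B_entry n m l k = 0"
    by (fact e)+
qed

end

section \<open>Integrals over the circle\<close>

definition circ :: "real \<Rightarrow> complex" where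
  "circ t = cis (2 * pi * t)"

lemma norm_circ [simp]: "norm (circ t) = 1"
  by (simp add: circ_def)

lemma circ_nonzero [simp]: "circ t \<noteq> 0"
  using norm_circ[of t] by force

lemma cnj_circ: "cnj (circ t) = circ (- t)" "cnj (circ t) = 1 / circ t"
  using complex_div_cnj[of 1 "circ t"] by (simp_all add: circ_def cis_cnj)

lemma circ_add: "circ (s + t) = circ s * circ t"
  by (simp add: circ_def cis_mult distrib_left)

lemma circ_plus_1 [simp]: "circ (t + 1) = circ t"
  by (simp add: circ_def cis.ctr distrib_left)

lemma circ_power: "circ t ^ k = cis (2 * pi * (real k * t))"
  by (simp only: circ_def Complex.DeMoivre mult_ac)

lemma continuous_on_circ [continuous_intros]:
  "continuous_on A f \<Longrightarrow> continuous_on A (\<lambda>x. circ (f x))"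
  unfolding circ_def by (intro continuous_intros)

text \<open>Cauchy's formula at the centre. The derivative of the path cancels the kernel, and the
  period 1 of \<open>circ\<close> makes the mean value a plain integral.\<close>

lemma mean_value_circle:
  assumes "g holomorphic_on cball 0 1"
  shows "((\<lambda>t. g (circ t)) has_integral g 0) {0..1}"
proof -
  have "((\<lambda>u. g u / (u - 0)) has_contour_integral (2 * of_real pi * \<i> * g 0)) (circlepath 0 1)"
    by (rule Cauchy_integral_circlepath_simple) (use assms in auto)
  moreover have "circlepath 0 1 x = circ x" for x
    by (simp add: circlepath circ_def cis_conv_exp mult_ac)
  moreover have "vector_derivative (circlepath 0 1) (at x) = 2 * of_real pi * \<i> * circ x" for x
    by (simp add: vector_derivative_circlepath circ_def cis_conv_exp mult_ac)
  ultimately have "((\<lambda>x. 2 * of_real pi * \<i> * g (circ x)) has_integral (2 * of_real pi * \<i> * g 0)) {0..1}"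
    by (simp add: has_contour_integral field_simps)
  from has_integral_mult_right[OF this, of "1 / (2 * of_real pi * \<i>)"] show ?thesis
    by simp
qed

lemma integral_reflect_01:
  fixes f :: "real \<Rightarrow> 'a::euclidean_space"
  shows "integral {0..1} (\<lambda>t. f (1 - t)) = integral {0..1} f"
proof -
  have "integral {0..1} (\<lambda>t. f (1 - t)) = integral {-1..-0} (\<lambda>t. f (1 - - t))"
    using Henstock_Kurzweil_Integration.integral_reflect_real[where f = "\<lambda>t. f (1 - t)" and a = 0 and b = 1] by simp
  also have "\<dots> = integral {0 - 1..1 - 1} (\<lambda>t. f (t + 1))"
    by (simp add: add.commute)
  also have "\<dots> = integral {0..1} f"
    by (rule integral_shift_real_ivl)
  finally show ?thesis .
qed

lemma integral_periodic_shift: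
  fixes f :: "real \<Rightarrow> 'a::euclidean_space"
  assumes cont: "continuous_on UNIV f" and per: "\<And>t. f (t + 1) = f t" and s: "0 \<le> s" "s \<le> 1"
  shows "integral {0..1} (\<lambda>t. f (t + s)) = integral {0..1} f"
proof -
  have int: "f integrable_on {a..b}" for a b
    by (intro integrable_continuous_real continuous_on_subset[OF cont]) auto
  have "integral {0..1} (\<lambda>t. f (t + s)) = integral {s..s + 1} f"
    using integral_shift_real_ivl[of s s "s + 1" f] by simp
  also have "\<dots> = integral {s..1} f + integral {1..s + 1} f"
    by (rule Henstock_Kurzweil_Integration.integral_combine[symmetric, OF _ _ int]) (use s in auto)
  also have "integral {1..s + 1} f = integral {0..s} (\<lambda>t. f (t + 1))"
    using integral_shift_real_ivl[of 1 1 "s + 1" f] by simp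
  also have "\<dots> = integral {0..s} f"
    by (simp add: per)
  also have "integral {s..1} f + integral {0..s} f = integral {0..1} f"
    by (subst add.commute, rule Henstock_Kurzweil_Integration.integral_combine[OF _ _ int]) (use s in auto)
  finally show ?thesis .
qed

text \<open>Over a full period the cosine covers the interval twice. The root becomes the absolute
  value of the sine, and the sine changes sign exactly where the direction of travel does, so both
  halves contribute equally.\<close>

lemma integral_chebyshev_substitution:
  fixes g :: "real \<Rightarrow> real"
  assumes cont: "continuous_on {-1..1} g"
  shows "integral {-1..1} (\<lambda>x. g x * sqrt (1 - x\<^sup>2)) =
    pi * integral {0..1} (\<lambda>t. g (cos (2 * pi * t)) * (sin (2 * pi * t))\<^sup>2)"
proof -
  define f where "f x = g x * sqrt (1 - x\<^sup>2)" for x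
  have f: "continuous_on {-1..1} f"
    unfolding f_def by (intro continuous_intros cont)
  define G where "G t = g (cos (2 * pi * t)) * (sin (2 * pi * t))\<^sup>2" for t
  have sqrt: "sqrt (1 - (cos u)\<^sup>2) = \<bar>sin u\<bar>" for u :: real
    by (simp flip: sin_squared_eq)
  \<comment> \<open>The general substitution rule yields a difference of two integrals; on each half
    period one of them runs over an empty interval.\<close>
  have sub: "((\<lambda>t. (- (2 * pi * sin (2 * pi * t))) *\<^sub>R f (cos (2 * pi * t))) has_integral
      (integral {cos (2 * pi * a)..cos (2 * pi * b)} f - integral {cos (2 * pi * b)..cos (2 * pi * a)} f)) {a..b}"
    if "a \<le> b" for a b
    by (rule has_integral_substitution_general[where c = "-1" and d = 1 and s = "{}", OF _ that _ f])
       (auto intro!: continuous_intros derivative_eq_intros)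
  have "((\<lambda>t. - (2 * pi) * G t) has_integral - integral {-1..1} f) {0..1/2}"
  proof (rule has_integral_eq[rotated])
    show "((\<lambda>t. (- (2 * pi * sin (2 * pi * t))) *\<^sub>R f (cos (2 * pi * t))) has_integral
        - integral {-1..1} f) {0..1/2}"
      using sub[of 0 "1/2"] by simp
    fix t :: real assume t: "t \<in> {0..1/2}"
    then have "sin (2 * pi * t) \<ge> 0"
      by (intro sin_ge_zero) auto
    then show "(- (2 * pi * sin (2 * pi * t))) *\<^sub>R f (cos (2 * pi * t)) = - (2 * pi) * G t"
      by (simp add: f_def G_def sqrt) (simp add: power2_eq_square)
  qed
  from has_integral_neg[OF this] have 1: "((\<lambda>t. 2 * pi * G t) has_integral integral {-1..1} f) {0..1/2}"
    by simp
  have 2: "((\<lambda>t. 2 * pi * G t) has_integral integral {-1..1} f) {1/2..1}"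
  proof (rule has_integral_eq[rotated])
    show "((\<lambda>t. (- (2 * pi * sin (2 * pi * t))) *\<^sub>R f (cos (2 * pi * t))) has_integral
        integral {-1..1} f) {1/2..1}"
      using sub[of "1/2" 1] by simp
    fix t :: real assume t: "t \<in> {1/2..1}"
    have "sin (2 * pi * t - pi) \<ge> 0"
      using t by (intro sin_ge_zero) (auto simp: algebra_simps)
    then have "sin (2 * pi * t) \<le> 0"
      by (simp add: sin_diff)
    then show "(- (2 * pi * sin (2 * pi * t))) *\<^sub>R f (cos (2 * pi * t)) = 2 * pi * G t"
      by (simp add: f_def G_def sqrt) (simp add: power2_eq_square)
  qed
  have "((\<lambda>t. 2 * pi * G t) has_integral (integral {-1..1} f + integral {-1..1} f)) {0..1}"
    using has_integral_combine[OF _ _ 1 2] by simp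
  from integral_unique[OF this] have "pi * integral {0..1} G = integral {-1..1} f"
    by simp
  then show ?thesis
    by (simp add: f_def[abs_def] G_def[abs_def])
qed

lemma cos_circ: "complex_of_real (cos (2 * pi * t)) = ((circ t)\<^sup>2 + 1) / (2 * circ t)"
proof -
  have "complex_of_real (cos (2 * pi * t)) = (circ t + cnj (circ t)) / 2"
    by (simp add: circ_def complex_add_cnj)
  then show ?thesis
    by (simp add: cnj_circ(2) field_simps power2_eq_square)
qed

lemma sin_circ: "complex_of_real (sin (2 * pi * t)) = ((circ t)\<^sup>2 - 1) / (2 * \<i> * circ t)"
proof -
  have "circ t - cnj (circ t) = complex_of_real (sin (2 * pi * t)) * (2 * \<i>)"
    by (simp add: circ_def complex_eq_iff)
  then have "complex_of_real (sin (2 * pi * t)) = (circ t - cnj (circ t)) / (2 * \<i>)"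
    by (subst nonzero_eq_divide_eq) simp_all
  then show ?thesis
    by (simp add: cnj_circ(2) field_simps power2_eq_square)
qed

lemma cos_power_sin_circ:
  "circ t ^ Suc j * complex_of_real (cos (2 * pi * t) ^ j * sin (2 * pi * t)) =
    ((circ t)\<^sup>2 + 1) ^ j * ((circ t)\<^sup>2 - 1) / (2 ^ j * (2 * \<i>))"
  by (simp add: cos_circ sin_circ power_divide power_mult_distrib)

lemma circle_pt_cos: "circle_pt (cos \<theta>) = cis \<theta> \<or> circle_pt (cos \<theta>) = cnj (cis \<theta>)"
proof -
  have "sqrt (1 - (cos \<theta>)\<^sup>2) = \<bar>sin \<theta>\<bar>"
    by (simp flip: sin_squared_eq)
  then show ?thesis
    by (auto simp: circle_pt_def complex_eq_iff abs_if)
qed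

lemma norm_circle_pt: "\<bar>x\<bar> \<le> 1 \<Longrightarrow> norm (circle_pt x) = 1"
  by (simp add: circle_pt_def cmod_def abs_square_le_1)

lemma continuous_on_circle_pt [continuous_intros]:
  "continuous_on A f \<Longrightarrow> continuous_on A (\<lambda>x. circle_pt (f x))"
  unfolding circle_pt_def Complex_eq by (intro continuous_intros)

text \<open>After x = cos, the integrand is the imaginary part of
  z^(n-j) (z^2+1)^j (z^2-1) / (2^(j+1) i H(z)), which is analytic in the disc.\<close>

lemma bernstein_szego:
  fixes H :: "nat \<Rightarrow> real" and N :: nat
  defines "Hz \<equiv> \<lambda>z. \<Sum>i\<le>N. complex_of_real (H i) * z ^ i"
  assumes nz: "\<And>z. norm z \<le> 1 \<Longrightarrow> Hz z \<noteq> 0" and "j \<le> n"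
  shows "integral {-1..1} (\<lambda>x. (\<Sum>i\<le>N. H i * poly (ucheb (int n + 1 - int i)) x) * x ^ j
      / (norm (Hz (circle_pt x)))\<^sup>2 * sqrt (1 - x\<^sup>2))
    = (if j = n then pi / (2 ^ Suc n * H 0) else 0)"
proof -
  define q where "q x = (\<Sum>i\<le>N. H i * poly (ucheb (int n + 1 - int i)) x)" for x
  have cont: "continuous_on {-1..1} (\<lambda>x. q x * x ^ j / (norm (Hz (circle_pt x)))\<^sup>2)"
    unfolding q_def using nz norm_circle_pt unfolding Hz_def
    by (intro continuous_intros) (auto simp: abs_le_iff)
  \<comment> \<open>\<open>n - j\<close> is what remains of the power \<open>n + 1\<close> after the
    \<open>j + 1\<close> denominators of the cosines and the sine. Hence the value at 0 vanishes
    unless \<open>j = n\<close>.\<close>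
  define G where "G z = z ^ (n - j) * ((z\<^sup>2 + 1) ^ j * (z\<^sup>2 - 1) / (2 ^ j * (2 * \<i>))) / Hz z" for z
  have "G holomorphic_on cball 0 1"
    unfolding G_def using nz unfolding Hz_def by (intro holomorphic_intros) auto
  note mean = mean_value_circle[OF this]
  have Hz0: "Hz 0 = H 0"
    by (simp add: Hz_def power_0_left if_distrib sum.delta cong: if_cong)
  \<comment> \<open>On the circle the i-th term of z^(n+1) times the conjugate of H(z) is
    \<open>H i\<close> z^(n+1-i), and its imaginary part is the sine that \<open>ucheb_cos\<close>
    supplies.\<close>
  have qsin: "q (cos (2 * pi * t)) * sin (2 * pi * t) = Im (circ t ^ Suc n * cnj (Hz (circ t)))" for t
  proof -
    have "circ t ^ Suc n * cnj (Hz (circ t)) = (\<Sum>i\<le>N. complex_of_real (H i) * cis (of_int (int n + 1 - int i) * (2 * pi * t)))"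
      unfolding Hz_def cnj_sum sum_distrib_left
    proof (intro sum.cong refl)
      fix i
      have "circ t ^ Suc n * cnj (circ t) ^ i = cis (of_int (int n + 1 - int i) * (2 * pi * t))"
        unfolding cnj_circ circ_power cis_mult by (simp add: algebra_simps)
      moreover have "circ t ^ Suc n * cnj (complex_of_real (H i) * circ t ^ i) =
          complex_of_real (H i) * (circ t ^ Suc n * cnj (circ t) ^ i)"
        by simp
      ultimately show "circ t ^ Suc n * cnj (complex_of_real (H i) * circ t ^ i) = complex_of_real (H i) * cis (of_int (int n + 1 - int i) * (2 * pi * t))"
        by (simp only:)
    qed
    then show ?thesis
      by (simp only: q_def sum_distrib_right mult.assoc ucheb_cos) simp
  qed
  have "q (cos (2 * pi * t)) * cos (2 * pi * t) ^ j / (norm (Hz (circle_pt (cos (2 * pi * t)))))\<^sup>2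
      * (sin (2 * pi * t))\<^sup>2 = Im (G (circ t))" for t
  proof -
    have cnj: "Hz (cnj z) = cnj (Hz z)" for z
      by (simp add: Hz_def)
    have n: "norm (Hz (circle_pt (cos (2 * pi * t)))) = norm (Hz (circ t))"
      using circle_pt_cos[of "2 * pi * t"] cnj[of "circ t"] by (auto simp: circ_def)
    let ?r = "cos (2 * pi * t) ^ j * sin (2 * pi * t)"
    have "circ t ^ Suc n = circ t ^ (n - j) * circ t ^ Suc j"
      using \<open>j \<le> n\<close> by (simp flip: power_add)
    then have "circ t ^ Suc n * complex_of_real ?r / Hz (circ t) = G (circ t)"
      unfolding G_def by (simp only: mult.assoc[of "circ t ^ (n - j)"] cos_power_sin_circ)
    \<comment> \<open>Dividing the conjugate of H by the squared modulus leaves 1/H; the absence of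
      zeros in the closed disc makes this analytic.\<close>
    moreover have "circ t ^ Suc n * complex_of_real ?r / Hz (circ t)
        = circ t ^ Suc n * cnj (Hz (circ t)) * complex_of_real (?r / (norm (Hz (circ t)))\<^sup>2)"
      using nz[of "circ t"] complex_norm_square[of "Hz (circ t)"] by (simp add: field_simps)
    ultimately have G: "G (circ t) = circ t ^ Suc n * cnj (Hz (circ t)) * complex_of_real (?r / (norm (Hz (circ t)))\<^sup>2)"
      by (simp only:)
    have "Im (a * complex_of_real c) = Im a * c" for a c
      by simp
    then have "Im (G (circ t)) = Im (circ t ^ Suc n * cnj (Hz (circ t))) * (?r / (norm (Hz (circ t)))\<^sup>2)"
      unfolding G .
    then show ?thesis
      unfolding n qsin[symmetric] by (simp add: power2_eq_square)
  qed
  then have "integral {-1..1} (\<lambda>x. q x * x ^ j / (norm (Hz (circle_pt x)))\<^sup>2 * sqrt (1 - x\<^sup>2)) =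
      pi * integral {0..1} (\<lambda>t. Im (G (circ t)))"
    by (simp only: integral_chebyshev_substitution[OF cont])
  also have "integral {0..1} (\<lambda>t. Im (G (circ t))) = Im (G 0)"
    using has_integral_Im[OF mean] by (simp add: integral_unique)
  also have "pi * Im (G 0) = (if j = n then pi / (2 ^ Suc n * H 0) else 0)"
  proof (cases "j = n")
    case True
    have "G 0 = \<i> * complex_of_real (1 / (2 ^ Suc n * H 0))"
      using True nz[of 0] by (simp add: G_def Hz0 field_simps)
    then show ?thesis using True by simp
  next
    case False
    then have "G 0 = 0"
      using \<open>j \<le> n\<close> by (simp add: G_def power_0_left)
    then show ?thesis using False by simp
  qed
  finally show ?thesis
    unfolding q_def .
qed

section \<open>The weighted measures\<close>

locale chebyshev_weight =
  fixes d :: "real \<Rightarrow> real \<Rightarrow> real"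
  assumes d_cont: "continuous_on ({-1..1} \<times> {-1..1}) (\<lambda>(x, y). d x y)"
    and d_pos: "\<And>x y. \<lbrakk>-1 \<le> x; x \<le> 1; -1 \<le> y; y \<le> 1\<rbrakk> \<Longrightarrow> d x y > 0"
begin

definition weight :: "real \<Rightarrow> real \<Rightarrow> real" where
  "weight x y = 4 / pi\<^sup>2 * (sqrt (1 - x\<^sup>2) * sqrt (1 - y\<^sup>2) / d x y)"

lemma weight_cont: "continuous_on ({-1..1} \<times> {-1..1}) (\<lambda>p. weight (fst p) (snd p))"
proof -
  have "continuous_on ({-1..1} \<times> {-1..1}) (\<lambda>p. d (fst p) (snd p))"
    using d_cont by (simp add: case_prod_beta)
  then show ?thesis
    unfolding weight_def by (intro continuous_intros) (use d_pos in fastforce)+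
qed

lemma weight_nonneg: "\<lbrakk>-1 \<le> x; x \<le> 1; -1 \<le> y; y \<le> 1\<rbrakk> \<Longrightarrow> weight x y \<ge> 0"
  using d_pos[of x y] unfolding weight_def
  by (intro mult_nonneg_nonneg divide_nonneg_pos real_sqrt_ge_zero) (auto simp: abs_square_le_1 abs_le_iff)

lemma weighted_measure_integral:
  fixes f :: "real \<times> real \<Rightarrow> real"
  assumes f: "continuous_on UNIV f"
  shows "integrable (weighted_measure d) f"
    and "(\<integral>p. f p \<partial>weighted_measure d) = integral (cbox (-1, -1) (1, 1)) (\<lambda>p. weight (fst p) (snd p) * f p)"
proof -
  define S where "S = {-1..1::real} \<times> {-1..1::real}"
  have S: "S = cbox (-1, -1) (1, 1)"
    by (simp add: S_def cbox_Pair_eq)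
  then have "compact S" by simp
  define w where "w p = indicator S p *\<^sub>R weight (fst p) (snd p)" for p
  have wf: "integrable lborel (\<lambda>p. indicator S p *\<^sub>R (weight (fst p) (snd p) * f p))"
    unfolding S_def
    by (intro borel_integrable_compact compact_Times compact_Icc continuous_intros weight_cont
        continuous_on_subset[OF f]) auto
  have "w \<in> borel_measurable borel"
    unfolding w_def S_def
    by (intro borel_measurable_continuous_on_indicator weight_cont) (simp add: closed_Times)
  then have w_meas: "w \<in> borel_measurable lborel"
    by simp
  have f_meas: "f \<in> borel_measurable lborel"
    using borel_measurable_continuous_onI[OF f] by simp
  have w_nonneg: "AE p in lborel. 0 \<le> w p"
    by (intro AE_I2) (auto simp: w_def S_def indicator_def weight_nonneg)
  have \<mu>: "weighted_measure d = density lborel (\<lambda>p. ennreal (w p))"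
    unfolding weighted_measure_def w_def S_def weight_def
    by (rule arg_cong[where f = "density lborel"]) (auto simp: fun_eq_iff indicator_def)
  show "integrable (weighted_measure d) f"
    unfolding \<mu> using wf
    by (subst integrable_density[OF f_meas w_meas w_nonneg]) (simp add: w_def mult_ac)
  have "(\<integral>p. f p \<partial>weighted_measure d) = (LINT p:S|lborel. weight (fst p) (snd p) * f p)"
    unfolding \<mu> set_lebesgue_integral_def
    by (subst integral_density[OF f_meas w_meas w_nonneg]) (simp add: w_def mult_ac)
  also have "\<dots> = integral S (\<lambda>p. weight (fst p) (snd p) * f p)"
    using wf by (intro set_borel_integral_eq_integral) (simp add: set_integrable_def)
  finally show "(\<integral>p. f p \<partial>weighted_measure d) = integral (cbox (-1, -1) (1, 1)) (\<lambda>p. weight (fst p) (snd p) * f p)"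
    unfolding S .
qed

lemma weighted_measure_iterated:
  fixes f :: "real \<times> real \<Rightarrow> real"
  assumes f: "continuous_on UNIV f"
  shows "(\<integral>p. f p \<partial>weighted_measure d) = integral {-1..1} (\<lambda>x. integral {-1..1} (\<lambda>y. weight x y * f (x, y)))"
    and "(\<integral>p. f p \<partial>weighted_measure d) = integral {-1..1} (\<lambda>y. integral {-1..1} (\<lambda>x. weight x y * f (x, y)))"
proof -
  have cont: "continuous_on (cbox (-1, -1) (1, 1)) (\<lambda>p. weight (fst p) (snd p) * f p)"
    unfolding cbox_Pair_eq using weight_cont
    by (intro continuous_intros continuous_on_subset[OF f]) auto
  show 1: "(\<integral>p. f p \<partial>weighted_measure d) = integral {-1..1} (\<lambda>x. integral {-1..1} (\<lambda>y. weight x y * f (x, y)))"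
    unfolding weighted_measure_integral(2)[OF f] integral_prod_continuous[OF cont] by simp
  have cont': "continuous_on (cbox (-1, -1) (1, 1)) (\<lambda>(x, y). weight x y * f (x, y))"
    using cont by (simp add: case_prod_beta)
  show "(\<integral>p. f p \<partial>weighted_measure d) = integral {-1..1} (\<lambda>y. integral {-1..1} (\<lambda>x. weight x y * f (x, y)))"
    unfolding 1 using integral_swap_continuous[OF cont'] by simp
qed

text \<open>Each substitution contributes a factor \<open>pi\<close>, which cancels against the
  \<open>4 / pi\<^sup>2\<close> of the density, and turns a square root into the square of a
  sine.\<close>

lemma weighted_measure_torus:
  fixes f :: "real \<times> real \<Rightarrow> real"
  assumes f: "continuous_on UNIV f"
  shows "(\<integral>p. f p \<partial>weighted_measure d) = 4 * integral {0..1} (\<lambda>s. integral {0..1} (\<lambda>t.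
    f (cos (2 * pi * s), cos (2 * pi * t)) / d (cos (2 * pi * s)) (cos (2 * pi * t))
      * (sin (2 * pi * s))\<^sup>2 * (sin (2 * pi * t))\<^sup>2))"
proof -
  define F where "F x y = f (x, y) / d x y" for x y
  have F_cont: "continuous_on ({-1..1} \<times> {-1..1}) (\<lambda>p. F (fst p) (snd p))"
  proof -
    have "continuous_on ({-1..1} \<times> {-1..1}) (\<lambda>p. d (fst p) (snd p))"
      using d_cont by (simp add: case_prod_beta)
    moreover have "continuous_on ({-1..1} \<times> {-1..1}) (\<lambda>p. f (fst p, snd p))"
      using continuous_on_subset[OF f] by simp
    ultimately show ?thesis
      unfolding F_def by (intro continuous_intros) (use d_pos in fastforce)+
  qed
  have Fx: "continuous_on {-1..1} (\<lambda>y. F x y)" if "x \<in> {-1..1}" for x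
    using that by (intro continuous_on_compose2[OF F_cont, of _ "\<lambda>y. (x, y)", simplified] continuous_intros) auto
  have inner: "integral {-1..1} (\<lambda>y. weight x y * f (x, y)) =
      4 / pi * (integral {0..1} (\<lambda>t. F x (cos (2 * pi * t)) * (sin (2 * pi * t))\<^sup>2) * sqrt (1 - x\<^sup>2))"
    if "x \<in> {-1..1}" for x
  proof -
    have "integral {-1..1} (\<lambda>y. weight x y * f (x, y)) =
        integral {-1..1} (\<lambda>y. 4 / pi\<^sup>2 * sqrt (1 - x\<^sup>2) * (F x y * sqrt (1 - y\<^sup>2)))"
      by (simp add: weight_def F_def mult_ac)
    also have "\<dots> = 4 / pi\<^sup>2 * sqrt (1 - x\<^sup>2) * (pi * integral {0..1} (\<lambda>t. F x (cos (2 * pi * t)) * (sin (2 * pi * t))\<^sup>2))"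
      by (simp only: integral_mult_right integral_chebyshev_substitution[OF Fx[OF that]])
    finally show ?thesis
      by (simp add: power2_eq_square)
  qed
  have Fc: "continuous_on ({-1..1} \<times> cbox 0 1) (\<lambda>(x, t). F x (cos (2 * pi * t)) * (sin (2 * pi * t))\<^sup>2)"
    unfolding case_prod_beta
    by (intro continuous_intros continuous_on_compose2[OF F_cont, of _ "\<lambda>p. (fst p, cos (2 * pi * snd p))", simplified]) auto
  have "continuous_on {-1..1} (\<lambda>x. integral {0..1} (\<lambda>t. F x (cos (2 * pi * t)) * (sin (2 * pi * t))\<^sup>2))"
    using integral_continuous_on_param[OF Fc] by simp
  note outer = integral_chebyshev_substitution[OF this]
  have "(\<integral>p. f p \<partial>weighted_measure d) = integral {-1..1} (\<lambda>x.
      4 / pi * (integral {0..1} (\<lambda>t. F x (cos (2 * pi * t)) * (sin (2 * pi * t))\<^sup>2) * sqrt (1 - x\<^sup>2)))"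
    unfolding weighted_measure_iterated(1)[OF f] by (intro integral_cong inner)
  also have "\<dots> = 4 * integral {0..1} (\<lambda>s. integral {0..1} (\<lambda>t. F (cos (2 * pi * s)) (cos (2 * pi * t)) * (sin (2 * pi * t))\<^sup>2) * (sin (2 * pi * s))\<^sup>2)"
    unfolding integral_mult_right outer by simp
  finally show ?thesis
    unfolding F_def integral_mult_left[symmetric] by (simp only: mult_ac)
qed

end

section \<open>The integral against a weight as a positive functional\<close>

lemma eval2_add: "eval2 (p + q) x y = eval2 p x y + eval2 q x y"
  by (simp add: eval2_def)

lemma eval2_mult: "eval2 (p * q) x y = eval2 p x y * eval2 q x y"
  by (simp add: eval2_def)

lemma eval2_smult: "eval2 (smult c p) x y = poly c y * eval2 p x y"
  by (simp add: eval2_def)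

lemma eval2_monom2: "eval2 (monom2 i j) x y = x ^ i * y ^ j"
  by (simp add: eval2_def monom2_def poly_monom)

lemma eval2_X: "eval2 [:0, 1:] x y = x"
  by (simp add: eval2_def)

lemma continuous_on_eval2: "continuous_on A (\<lambda>p. eval2 q (fst p) (snd p))"
  unfolding eval2_altdef by (intro continuous_intros)

text \<open>Root counting twice: for fixed x over the reals, and then over the ring of polynomials
  in y, where all constants \<open>[:x:]\<close> from an interval would be roots of
  \<open>p\<close>.\<close>

lemma eval2_eq_0_imp:
  assumes "\<And>x y. \<lbrakk>-1 < x; x < 1; -1 < y; y < 1\<rbrakk> \<Longrightarrow> eval2 p x y = 0"
  shows "p = 0"
proof (rule ccontr)
  assume "p \<noteq> 0"
  have "poly p [:x:] = 0" if "-1 < x" "x < 1" for x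
  proof (rule ccontr)
    assume "poly p [:x:] \<noteq> 0"
    then have "finite {y. poly (poly p [:x:]) y = 0}"
      by (rule poly_roots_finite)
    moreover have "{-1<..<1} \<subseteq> {y. poly (poly p [:x:]) y = 0}"
      using assms that by (auto simp: eval2_def)
    ultimately have "finite {-1<..<1::real}"
      by (rule finite_subset[rotated])
    then show False
      using infinite_Ioo[of "-1" "1::real"] by simp
  qed
  then have "(\<lambda>x. [:x:]) ` {-1<..<1} \<subseteq> {q. poly p q = 0}"
    by auto
  moreover have "finite {q. poly p q = 0}"
    using \<open>p \<noteq> 0\<close> by (rule poly_roots_finite)
  ultimately have "finite ((\<lambda>x. [:x:]) ` {-1<..<1::real})"
    by (rule finite_subset)
  then show False
    using infinite_Ioo[of "-1" "1::real"] by (simp add: finite_image_iff inj_on_def)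
qed

context chebyshev_weight
begin

definition L :: "real poly poly \<Rightarrow> real" where
  "L p = (\<integral>(x, y). eval2 p x y \<partial>weighted_measure d)"

lemma L_alt: "L p = (\<integral>q. eval2 p (fst q) (snd q) \<partial>weighted_measure d)"
  unfolding L_def case_prod_unfold ..

lemma L_box: "L p = integral (cbox (-1, -1) (1, 1)) (\<lambda>q. weight (fst q) (snd q) * eval2 p (fst q) (snd q))"
  unfolding L_alt by (rule weighted_measure_integral(2)[OF continuous_on_eval2])

text \<open>A continuous nonnegative integrand with integral 0 vanishes on the whole box, and the
  weight is positive in the interior, so \<open>p\<close> would vanish on an open square.\<close>

lemma L_mult_self_pos:
  assumes "p \<noteq> 0"
  shows "L (p * p) > 0"
proof -
  define F where "F q = weight (fst q) (snd q) * eval2 (p * p) (fst q) (snd q)" for q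
  have F_nonneg: "F q \<ge> 0" if "q \<in> cbox (-1, -1) (1, 1)" for q
    using that weight_nonneg[of "fst q" "snd q"] by (auto simp: F_def eval2_mult cbox_Pair_eq)
  have F_cont: "continuous_on (cbox (-1, -1) (1, 1)) F"
    unfolding F_def cbox_Pair_eq using weight_cont by (intro continuous_intros continuous_on_eval2) simp
  have "integral (cbox (-1, -1) (1, 1)) F \<noteq> 0"
  proof
    assume "integral (cbox (-1, -1) (1, 1)) F = 0"
    moreover have "(0, 0) \<in> box (-1, -1) (1 :: real, 1 :: real)"
      by (simp add: box_def Basis_prod_def Basis_real_def)
    then have "box (-1, -1) (1, 1) \<noteq> ({} :: (real \<times> real) set)"
      by (metis empty_iff)
    note integral_cbox_eq_0_iff[OF F_cont this F_nonneg]
    ultimately have "\<forall>q\<in>cbox (-1, -1) (1, 1). F q = 0"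
      by simp
    then have F0: "F q = 0" if "q \<in> cbox (-1, -1) (1, 1)" for q
      using that by (rule bspec)
    have "eval2 p x y = 0" if "-1 < x" "x < 1" "-1 < y" "y < 1" for x y
    proof -
      have "weight x y > 0"
        using that d_pos[of x y] by (simp add: weight_def abs_square_less_1)
      moreover have "F (x, y) = 0"
        using that by (intro F0) (auto simp: cbox_Pair_eq)
      ultimately show ?thesis
        by (simp add: F_def eval2_mult)
    qed
    then show False
      using eval2_eq_0_imp assms by blast
  qed
  moreover have "integral (cbox (-1, -1) (1, 1)) F \<ge> 0"
    by (rule integral_nonneg[OF integrable_continuous[OF F_cont] F_nonneg])
  ultimately show ?thesis
    unfolding L_box F_def by simp
qed

sublocale pos_functional L
proof
  have int: "integrable (weighted_measure d) (\<lambda>q. eval2 p (fst q) (snd q))" for p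
    by (rule weighted_measure_integral(1)[OF continuous_on_eval2])
  show "L (p + q) = L p + L q" for p q
    unfolding L_alt eval2_add using int by simp
  show "L (smult [:c:] p) = c * L p" for c p
    unfolding L_alt eval2_smult by simp
  show "L (p * p) > 0" if "p \<noteq> 0" for p
    using that by (rule L_mult_self_pos)
qed

lemma is_lex_onp_eq: "is_lex_onp (weighted_measure d) n m l = onp n m l"
  by (auto simp: fun_eq_iff is_lex_onp_def onp_def L_def supp_in_def lex_le_def lex_less_def
      eval2_mult eval2_monom2 power2_eq_square)

lemma lex_onp_eq: "lex_onp (weighted_measure d) n m l = the_onp n m l"
  by (simp add: lex_onp_def the_onp_def is_lex_onp_eq)

lemma A_lex_eq: "A_lex (weighted_measure d) n m = Matrix.mat (m + 1) (m + 1) (\<lambda>(k, l). A_entry n m k l)"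
  by (simp add: A_lex_def lex_onp_eq A_entry_def L_def eval2_mult eval2_X mult.assoc del: mult_pCons_left)

lemma B_lex_eq: "B_lex (weighted_measure d) n m = Matrix.mat (m + 1) (m + 1) (\<lambda>(k, l). B_entry n m k l)"
  by (simp add: B_lex_def lex_onp_eq B_entry_def L_def eval2_mult eval2_X mult.assoc del: mult_pCons_left)

end

text \<open>Used with \<open>c = 1 / 2\<close> for A and \<open>c = 0\<close> for B. The last block
  simply collects the remaining entries, and either block size may be 0.\<close>

lemma mat_eq_four_block:
  fixes E :: "nat \<Rightarrow> nat \<Rightarrow> real"
  assumes "m + 1 = M + \<kappa>"
    and "\<And>k l. k \<le> m \<Longrightarrow> l < M \<Longrightarrow> E k l = (if k = l then c else 0)"
    and "\<And>k l. k \<le> m \<Longrightarrow> l < M \<Longrightarrow> E l k = (if k = l then c else 0)"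
  shows "Matrix.mat (m + 1) (m + 1) (\<lambda>(k, l). E k l) =
    four_block_mat (c \<cdot>\<^sub>m 1\<^sub>m M) (0\<^sub>m M \<kappa>) (0\<^sub>m \<kappa> M)
      (Matrix.mat \<kappa> \<kappa> (\<lambda>(i, j). E (M + i) (M + j)))"
  using assms by (intro eq_matI) (auto simp: not_less)

section \<open>Densities that are reciprocals of polynomials in z\<close>

locale bernstein_szego_weight =
  fixes N :: nat and h :: "nat \<Rightarrow> real poly"
  assumes h0: "h 0 = 1"
    and h_nz: "\<And>z y. \<lbrakk>norm z \<le> 1; -1 \<le> y; y \<le> 1\<rbrakk> \<Longrightarrow> h_eval N h z y \<noteq> 0"
begin

abbreviation dens :: "real \<Rightarrow> real \<Rightarrow> real" where
  "dens x y \<equiv> (norm (h_eval N h (circle_pt x) y))\<^sup>2"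

sublocale chebyshev_weight dens
proof
  show "continuous_on ({-1..1} \<times> {-1..1}) (\<lambda>(x, y). dens x y)"
    unfolding h_eval_def case_prod_beta by (intro continuous_intros continuous_on_poly)
  show "dens x y > 0" if "-1 \<le> x" "x \<le> 1" "-1 \<le> y" "y \<le> 1" for x y
    using h_nz[of "circle_pt x" y] that norm_circle_pt[of x] by simp
qed

lemma mu_h_eq: "mu_h N h = weighted_measure dens"
  by (simp add: mu_h_def)

lemma integral_ucheb_power:
  assumes "j \<le> l"
  shows "integral {-1..1} (\<lambda>y. poly (ucheb (int l + 1)) y * y ^ j * sqrt (1 - y\<^sup>2)) =
    (if j = l then pi / 2 ^ Suc l else 0)"
  using bernstein_szego[where N = 0 and H = "\<lambda>_. 1" and j = j and n = l] assms by simp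

text \<open>The x-integral is taken inside. It depends on y only through
  \<open>H 0 = h_0(y) = 1\<close>, so the density leaves no trace in y and the outer integral is the
  plain Chebyshev one. For \<open>i < n\<close> the inner integral is already 0, whatever
  \<open>j\<close> is.\<close>

lemma L_family:
  assumes "i \<le> n" "i = n \<Longrightarrow> j \<le> l"
  shows "L (cheb_family (\<lambda>i. h i * ucheb (int l + 1)) N (int n + 1) * monom2 i j) =
    (if i = n \<and> j = l then 1 / 2 ^ (n + l) else 0)"
proof -
  let ?F = "cheb_family (\<lambda>i. h i * ucheb (int l + 1)) N (int n + 1) * monom2 i j"
  have inner: "integral {-1..1} (\<lambda>x. weight x y * eval2 ?F x y) =
      4 / pi\<^sup>2 * (if i = n then pi / 2 ^ Suc n else 0) * (poly (ucheb (int l + 1)) y * y ^ j * sqrt (1 - y\<^sup>2))"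
    if "y \<in> {-1..1}" for y
  proof -
    define H where "H i = poly (h i) y" for i
    have Hz: "(\<Sum>i\<le>N. complex_of_real (H i) * z ^ i) = h_eval N h z y" for z
      by (simp add: H_def h_eval_def atMost_atLeast0)
    have "weight x y * eval2 ?F x y = 4 / pi\<^sup>2 * (poly (ucheb (int l + 1)) y * y ^ j * sqrt (1 - y\<^sup>2)) *
        ((\<Sum>i\<le>N. H i * poly (ucheb (int n + 1 - int i)) x) * x ^ i
          / (norm (h_eval N h (circle_pt x) y))\<^sup>2 * sqrt (1 - x\<^sup>2))" for x
    proof -
      have "eval2 ?F x y = (\<Sum>i\<le>N. H i * poly (ucheb (int n + 1 - int i)) x) * poly (ucheb (int l + 1)) y * (x ^ i * y ^ j)"
        by (simp add: eval2_mult eval2_monom2 eval2_cheb_family H_def sum_distrib_left sum_distrib_right mult_ac)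
      then show ?thesis
        by (simp add: weight_def)
    qed
    moreover have "integral {-1..1} (\<lambda>x. (\<Sum>i\<le>N. H i * poly (ucheb (int n + 1 - int i)) x) * x ^ i
          / (norm (h_eval N h (circle_pt x) y))\<^sup>2 * sqrt (1 - x\<^sup>2)) = (if i = n then pi / (2 ^ Suc n * H 0) else 0)"
      using bernstein_szego[where N = N and H = H and j = i and n = n] h_nz that \<open>i \<le> n\<close> unfolding Hz by auto
    moreover have "H 0 = 1"
      by (simp add: H_def h0)
    ultimately show ?thesis
      by (simp only: integral_mult_right) simp
  qed
  have "L ?F = integral {-1..1} (\<lambda>y. integral {-1..1} (\<lambda>x. weight x y * eval2 ?F x y))"
    unfolding L_alt weighted_measure_iterated(2)[OF continuous_on_eval2] by simp
  also have "\<dots> = integral {-1..1} (\<lambda>y. 4 / pi\<^sup>2 * (if i = n then pi / 2 ^ Suc n else 0) *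
      (poly (ucheb (int l + 1)) y * y ^ j * sqrt (1 - y\<^sup>2)))"
    by (intro integral_cong inner)
  also have "\<dots> = 4 / pi\<^sup>2 * (if i = n then pi / 2 ^ Suc n else 0) *
      integral {-1..1} (\<lambda>y. poly (ucheb (int l + 1)) y * y ^ j * sqrt (1 - y\<^sup>2))"
    by (rule integral_mult_right)
  also have "\<dots> = (if i = n \<and> j = l then 1 / 2 ^ (n + l) else 0)"
    using assms(2) by (auto simp: integral_ucheb_power power_add power2_eq_square[of pi])
  finally show ?thesis .
qed

text \<open>The degree condition keeps h_i U_l within y-degree \<open>m\<close>. The leading
  coefficient is 2^(n+l) and cancels the value 1 / 2^(n+l) from \<open>L_family\<close>, so the
  family is normalised as it stands.\<close>

lemma entries:
  assumes "\<And>i. i \<le> N \<Longrightarrow> degree (h i) + l \<le> m" "N < 2 * n" "k \<le> m"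
  shows "A_entry n m k l = (if k = l then 1 / 2 else 0)"
    and "A_entry n m l k = (if k = l then 1 / 2 else 0)"
    and "B_entry n m k l = 0"
    and "B_entry n m l k = 0"
proof -
  define g where "g i = h i * ucheb (int l + 1)" for i
  have deg: "degree (g i) \<le> m" if "i \<le> N" for i
    using degree_mult_le[of "h i" "ucheb (int l + 1)"] degree_ucheb_le[of "int l + 1" l, where 'a = real]
      assms(1)[OF that] by (simp add: g_def)
  have g0: "degree (g 0) \<le> l" "coeff (g 0) l = 2 ^ l"
    using degree_ucheb_le[of "int l + 1" l, where 'a = real] by (simp_all add: g_def h0 coeff_ucheb_lead)
  have l: "l \<le> m"
    using assms(1)[of 0] by simp
  have orth: "L (cheb_family g N (int \<nu> + 1) * monom2 i j) = 0" if "(i, j) \<in> lex_less \<nu> m l" for \<nu> i j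
    using that L_family[of i \<nu> j l] by (auto simp: lex_less_def g_def[abs_def])
  have norm: "2 ^ \<nu> * coeff (g 0) l * L (cheb_family g N (int \<nu> + 1) * monom2 \<nu> l) = 1" for \<nu>
    using L_family[of \<nu> \<nu> l l] g0(2) by (simp add: g_def[abs_def] power_add)
  note E = entries_of_cheb_family[where g = g and K = N and m = m and n = n and l = l and k = k,
      OF deg assms(2) g0(1) l _ orth norm assms(3)]
  show "A_entry n m k l = (if k = l then 1 / 2 else 0)"
    and "A_entry n m l k = (if k = l then 1 / 2 else 0)"
    and "B_entry n m k l = 0" and "B_entry n m l k = 0"
    using E g0(2) by auto
qed

text \<open>The indices \<open>l < m + 1 - \<kappa>\<close> are those for which every h_i U_l fits
  into y-degree \<open>m\<close>. The properties of C and D are inherited from the general facts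
  about A and B.\<close>

lemma block_form:
  assumes deg: "\<And>i. i \<le> N \<Longrightarrow> degree (h i) \<le> \<kappa>" and "N < 2 * n" and m: "\<kappa> \<le> m + 1"
  shows "\<exists>C D. C \<in> carrier_mat \<kappa> \<kappa> \<and> D \<in> carrier_mat \<kappa> \<kappa> \<and>
         (\<forall>i<\<kappa>. \<forall>j<\<kappa>. i < j \<longrightarrow> C $$ (i, j) = 0) \<and>
         (\<forall>i<\<kappa>. C $$ (i, i) > 0) \<and>
         transpose_mat D = D \<and>
         A_lex (mu_h N h) n m =
           four_block_mat ((1 / 2) \<cdot>\<^sub>m 1\<^sub>m (m + 1 - \<kappa>)) (0\<^sub>m (m + 1 - \<kappa>) \<kappa>)
                          (0\<^sub>m \<kappa> (m + 1 - \<kappa>)) C \<and>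
         B_lex (mu_h N h) n m =
           four_block_mat (0\<^sub>m (m + 1 - \<kappa>) (m + 1 - \<kappa>)) (0\<^sub>m (m + 1 - \<kappa>) \<kappa>)
                          (0\<^sub>m \<kappa> (m + 1 - \<kappa>)) D"
proof -
  define M where "M = m + 1 - \<kappa>"
  have M: "m + 1 = M + \<kappa>"
    using m by (simp add: M_def)
  define C where "C = Matrix.mat \<kappa> \<kappa> (\<lambda>(i, j). A_entry n m (M + i) (M + j))"
  define D where "D = Matrix.mat \<kappa> \<kappa> (\<lambda>(i, j). B_entry n m (M + i) (M + j))"
  have n: "n \<ge> 1"
    using assms(2) by simp
  have dl: "degree (h i) + l \<le> m" if "l < M" "i \<le> N" for l i
    using deg[OF that(2)] that(1) M by simp
  note E = entries[OF dl \<open>N < 2 * n\<close>]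
  have "A_lex (mu_h N h) n m = four_block_mat ((1 / 2) \<cdot>\<^sub>m 1\<^sub>m M) (0\<^sub>m M \<kappa>) (0\<^sub>m \<kappa> M) C"
    unfolding mu_h_eq A_lex_eq C_def by (rule mat_eq_four_block[OF M]) (simp_all add: E)
  moreover have "B_lex (mu_h N h) n m = four_block_mat (0 \<cdot>\<^sub>m 1\<^sub>m M) (0\<^sub>m M \<kappa>) (0\<^sub>m \<kappa> M) D"
    unfolding mu_h_eq B_lex_eq D_def by (rule mat_eq_four_block[OF M]) (simp_all add: E)
  moreover have "0 \<cdot>\<^sub>m 1\<^sub>m M = (0\<^sub>m M M :: real mat)"
    by (intro eq_matI) auto
  moreover have "C \<in> carrier_mat \<kappa> \<kappa>" "D \<in> carrier_mat \<kappa> \<kappa>"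
    by (simp_all add: C_def D_def)
  moreover have "C $$ (i, j) = 0" if "i < j" "j < \<kappa>" for i j
    using that M A_entry_upper_zero[OF n, of "M + i" "M + j" m] by (simp add: C_def)
  moreover have "C $$ (i, i) > 0" if "i < \<kappa>" for i
    using that M A_entry_diag_pos[OF n, of "M + i" m] by (simp add: C_def)
  moreover have "transpose_mat D = D"
    by (intro eq_matI) (auto simp: D_def B_entry_sym)
  ultimately show ?thesis
    unfolding M_def by (intro exI[of _ C] exI[of _ D]) auto
qed

end

section \<open>Integrals over the torus\<close>

abbreviation torus_integral :: "(real \<Rightarrow> real \<Rightarrow> 'a::euclidean_space) \<Rightarrow> 'a" where
  "torus_integral f \<equiv> integral (cbox (0, 0) (1, 1)) (\<lambda>p. f (fst p) (snd p))"

lemma torus_integral_iterated: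
  fixes f :: "real \<Rightarrow> real \<Rightarrow> 'a::euclidean_space"
  assumes "continuous_on UNIV (\<lambda>p. f (fst p) (snd p))"
  shows "torus_integral f = integral {0..1} (\<lambda>s. integral {0..1} (\<lambda>t. f s t))"
    and "torus_integral f = integral {0..1} (\<lambda>t. integral {0..1} (\<lambda>s. f s t))"
proof -
  have cont: "continuous_on (cbox (0, 0) (1, 1)) (\<lambda>p. f (fst p) (snd p))"
    by (rule continuous_on_subset[OF assms]) simp
  show 1: "torus_integral f = integral {0..1} (\<lambda>s. integral {0..1} (\<lambda>t. f s t))"
    using integral_prod_continuous[OF cont] by simp
  have cont': "continuous_on (cbox (0, 0) (1, 1)) (\<lambda>(x, y). f x y)"
    using cont by (simp add: case_prod_beta)
  show "torus_integral f = integral {0..1} (\<lambda>t. integral {0..1} (\<lambda>s. f s t))"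
    unfolding 1 using integral_swap_continuous[OF cont'] by simp
qed

lemma circ_of_int [simp]: "circ (of_int k) = 1"
  unfolding circ_def by (rule cis_multiple_2pi) simp

lemma circ_int_mult_plus_1 [simp]: "circ (of_int k * (t + 1)) = circ (of_int k * t)"
  by (simp add: distrib_left circ_add)

lemma circ_of_nat_mult: "circ (real k * t) = circ t ^ k"
  by (simp only: circ_power) (simp add: circ_def)

lemma circ_reflect: "circ (of_int k * (1 - t)) = circ (of_int (- k) * t)"
  using circ_add[of "of_int k" "of_int (- k) * t"] by (simp add: algebra_simps)

lemma integral_circ_int: "integral {0..1} (\<lambda>t. circ (of_int k * t)) = (if k = 0 then 1 else 0)"
proof -
  have nat: "integral {0..1} (\<lambda>t. circ (real n * t)) = (if n = 0 then 1 else 0)" for n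
  proof -
    have "(\<lambda>z :: complex. z ^ n) holomorphic_on cball 0 1"
      by (intro holomorphic_intros)
    then show ?thesis
      using integral_unique[OF mean_value_circle[of "\<lambda>z. z ^ n"]] by (simp add: circ_of_nat_mult power_0_left)
  qed
  show ?thesis
  proof (cases "k \<ge> 0")
    case True
    then show ?thesis using nat[of "nat k"] by simp
  next
    case False
    have "integral {0..1} (\<lambda>t. circ (of_int k * t)) = integral {0..1} (\<lambda>t. circ (of_int (- k) * t))"
      using integral_reflect_01[of "\<lambda>t. circ (of_int k * t)"] by (simp only: circ_reflect)
    then show ?thesis using nat[of "nat (- k)"] False by simp
  qed
qed

text \<open>\<open>W\<close> abstracts T(u) / abs(\<omega>(u))^2 as a function of the angle of u.
  What counts is that its moments vanish for \<open>D\<close> consecutive frequencies on one side of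
  0.\<close>

locale torus_kernel =
  fixes W :: "real \<Rightarrow> complex" and D :: nat
  assumes W_cont: "continuous_on UNIV W"
    and W_periodic: "W (t + 1) = W t"
    and W_moments: "\<lbrakk>1 \<le> r; r \<le> D\<rbrakk> \<Longrightarrow> integral {0..1} (\<lambda>x. circ (of_int (- int r) * x) * W x) = 0"
begin

text \<open>With z = \<open>circ s\<close> and w = \<open>circ t\<close>, the torus integral of z^a
  w^b g(zw) W(w/z), where W takes the angle of its argument.\<close>

definition J :: "(complex \<Rightarrow> complex) \<Rightarrow> int \<Rightarrow> int \<Rightarrow> complex" where
  "J g a b = torus_integral (\<lambda>s t. circ (of_int a * s + of_int b * t) * g (circ (s + t)) * W (t - s))"

lemma continuous_on_holomorphic_circ:
  assumes "g holomorphic_on cball 0 1" "continuous_on A f"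
  shows "continuous_on A (\<lambda>p. g (circ (f p)))"
  by (rule continuous_on_compose2[OF holomorphic_on_imp_continuous_on[OF assms(1)]])
     (auto intro!: continuous_intros assms(2))

lemma continuous_on_W: "continuous_on A f \<Longrightarrow> continuous_on A (\<lambda>p. W (f p))"
  by (rule continuous_on_compose2[OF W_cont]) auto

lemma J_integrand_cont:
  assumes "g holomorphic_on cball 0 1"
  shows "continuous_on A (\<lambda>p. circ (of_int a * fst p + of_int b * snd p) * g (circ (fst p + snd p)) * W (snd p - fst p))"
  by (intro continuous_intros continuous_on_holomorphic_circ[OF assms] continuous_on_W)

text \<open>The substitution w = u z decouples the variables: the integral over z is a mean value of
  an analytic function, the one over u is a moment of W.\<close>

lemma J_decouple:
  assumes g: "g holomorphic_on cball 0 1"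
  shows "J g a b = integral {0..1} (\<lambda>t. integral {0..1} (\<lambda>s.
    circ (of_int (a + b) * s) * g (circ t * (circ s)\<^sup>2)) * (circ (of_int b * t) * W t))"
proof -
  define f where "f s t = circ (of_int a * s + of_int b * t) * g (circ (s + t)) * W (t - s)" for s t
  define f' where "f' s t = circ (of_int (a + b) * s) * g (circ t * (circ s)\<^sup>2) * (circ (of_int b * t) * W t)" for s t
  have f_cont: "continuous_on UNIV (\<lambda>p. f (fst p) (snd p))"
    unfolding f_def by (rule J_integrand_cont[OF g])
  have shift: "integral {0..1} (\<lambda>t. f s t) = integral {0..1} (\<lambda>t. f' s t)" if "s \<in> {0..1}" for s
  proof -
    have per: "f s (t + 1) = f s t" for t
    proof -
      have "circ (of_int a * s + of_int b * (t + 1)) = circ (of_int a * s + of_int b * t)"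
        by (simp add: circ_add)
      moreover have "circ (s + (t + 1)) = circ (s + t)"
        by (simp add: circ_plus_1 flip: add.assoc)
      moreover have "W (t + 1 - s) = W (t - s)"
        using W_periodic[of "t - s"] by (simp add: algebra_simps)
      ultimately show ?thesis by (simp only: f_def)
    qed
    have "continuous_on UNIV (\<lambda>t. f s t)"
      unfolding f_def by (intro continuous_intros continuous_on_holomorphic_circ[OF g] continuous_on_W)
    from integral_periodic_shift[OF this per]
    have "integral {0..1} (\<lambda>t. f s t) = integral {0..1} (\<lambda>t. f s (t + s))"
      using that by simp
    \<comment> \<open>Now \<open>t\<close> is the angle of u = w/z: the monomial becomes z^(a+b)
      u^b, and zw becomes u z^2.\<close>
    moreover have "f s (t + s) = f' s t" for t
    proof -
      have "circ (of_int a * s + of_int b * (t + s)) = circ (of_int (a + b) * s) * circ (of_int b * t)"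
        by (simp add: circ_add algebra_simps)
      moreover have "circ (s + (t + s)) = circ t * (circ s)\<^sup>2"
        by (simp only: circ_add power2_eq_square mult_ac)
      ultimately show ?thesis
        by (simp add: f_def f'_def)
    qed
    ultimately show ?thesis by simp
  qed
  have f'_cont: "continuous_on UNIV (\<lambda>p. f' (fst p) (snd p))"
  proof -
    have "circ t * (circ s)\<^sup>2 = circ (t + (s + s))" for s t
      by (simp only: circ_add power2_eq_square mult_ac)
    then show ?thesis
      unfolding f'_def
      by (simp only:) (intro continuous_intros continuous_on_holomorphic_circ[OF g] continuous_on_W)
  qed
  have "J g a b = integral {0..1} (\<lambda>s. integral {0..1} (\<lambda>t. f s t))"
    using torus_integral_iterated(1)[OF f_cont] by (simp add: J_def f_def)
  also have "\<dots> = integral {0..1} (\<lambda>s. integral {0..1} (\<lambda>t. f' s t))"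
    by (intro integral_cong shift)
  also have "\<dots> = integral {0..1} (\<lambda>t. integral {0..1} (\<lambda>s. f' s t))"
    using torus_integral_iterated[OF f'_cont] by simp
  finally show ?thesis
    by (simp only: f'_def integral_mult_left)
qed

text \<open>For \<open>a + b \<ge> 0\<close> the function z^(a+b) g(u z^2) is analytic in z, and its
  value at 0 does not depend on u. What remains is a single moment of \<open>W\<close>.\<close>

lemma J_nonneg:
  assumes g: "g holomorphic_on cball 0 1" and "a + b \<ge> 0"
  shows "J g a b = (if a + b = 0 then g 0 else 0) * integral {0..1} (\<lambda>x. circ (of_int b * x) * W x)"
proof -
  have mean: "integral {0..1} (\<lambda>s. circ (of_int (a + b) * s) * g (circ t * (circ s)\<^sup>2)) =
      (if a + b = 0 then g 0 else 0)" for t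
  proof -
    define k where "k = nat (a + b)"
    have k: "real_of_int (a + b) = real k"
      using assms(2) by (simp add: k_def)
    have "(\<lambda>z. z ^ k * g (circ t * z\<^sup>2)) holomorphic_on cball 0 1"
      by (intro holomorphic_intros holomorphic_on_compose_gen[OF _ g, unfolded o_def])
         (auto simp: norm_mult norm_power power_le_one)
    note mv = integral_unique[OF mean_value_circle[OF this]]
    show ?thesis
      unfolding k circ_of_nat_mult mv using assms(2) by (auto simp: k_def power_0_left)
  qed
  show ?thesis
    unfolding J_decouple[OF g] mean integral_mult_right ..
qed

text \<open>Without an analytic factor the z-integral is that of a pure power, which vanishes for
  negative exponents as well.\<close>

lemma J_const: "a + b \<noteq> 0 \<Longrightarrow> J (\<lambda>z. c) a b = 0"
  by (subst J_decouple) (simp_all only: integral_mult_left integral_circ_int, simp_all)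

text \<open>If \<open>a + b > 0\<close>, the mean value is 0. If \<open>a + b = 0\<close>, then
  \<open>b = - a\<close> with \<open>1 \<le> a \<le> D\<close>, and the moment vanishes. If
  \<open>a + b < 0\<close>, writing g(z) = g(0) + z g1(z) leaves a constant, handled by
  \<open>J_const\<close>, and a term with both exponents raised by one; the bounds on
  \<open>a\<close> and \<open>b\<close> persist, and \<open>a + 1\<close> cannot be 0.\<close>

lemma J_eq_0:
  assumes "g holomorphic_on cball 0 1" "a \<ge> 0" "b \<ge> - int D" "(a, b) \<noteq> (0, 0)"
  shows "J g a b = 0"
  using assms
proof (induction "nat (- (a + b))" arbitrary: a b g rule: less_induct)
  case less
  note g = less.prems(1)
  show ?case
  proof (cases "a + b \<ge> 0")
    case True
    then show ?thesis
    proof (cases "a + b = 0")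
      case True
      with less.prems have b: "b = - int (nat a)" "1 \<le> nat a" "nat a \<le> D"
        by auto
      then have "integral {0..1} (\<lambda>x. circ (of_int b * x) * W x) = 0"
        using W_moments[of "nat a"] by metis
      then show ?thesis
        using J_nonneg[OF g, of a b] True by simp
    next
      case False
      then show ?thesis
        using J_nonneg[OF g, of a b] True by simp
    qed
  next
    case False
    define g1 where "g1 z = (if z = 0 then deriv g 0 else (g z - g 0) / (z - 0))" for z
    have g1: "g1 holomorphic_on cball 0 1"
      unfolding g1_def by (rule pole_lemma[OF g]) simp
    have g_split: "g z = g 0 + z * g1 z" for z
      by (simp add: g1_def)
    have const: "(\<lambda>z. g 0) holomorphic_on cball 0 1"
      by simp
    have "J g a b = J (\<lambda>z. g 0) a b + J g1 (a + 1) (b + 1)"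
    proof -
      have "circ (of_int a * s + of_int b * t) * g (circ (s + t)) * W (t - s) =
          circ (of_int a * s + of_int b * t) * g 0 * W (t - s) +
          circ (of_int (a + 1) * s + of_int (b + 1) * t) * g1 (circ (s + t)) * W (t - s)" for s t
      proof -
        have "circ (of_int (a + 1) * s + of_int (b + 1) * t) = circ (of_int a * s + of_int b * t) * circ (s + t)"
          by (subst circ_add[symmetric]) (simp add: algebra_simps)
        then show ?thesis
          by (subst g_split) (simp only: distrib_left distrib_right mult.assoc)
      qed
      then show ?thesis
        unfolding J_def
        by (simp only:)
           (intro integral_add integrable_continuous J_integrand_cont[OF const] J_integrand_cont[OF g1])
    qed
    also have "J g1 (a + 1) (b + 1) = 0"
      by (rule less.hyps) (use False less.prems g1 in auto)
    also have "J (\<lambda>z. g 0) a b = 0"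
      using False by (intro J_const) simp
    finally show ?thesis by simp
  qed
qed

lemma J_0_0: "g holomorphic_on cball 0 1 \<Longrightarrow> J g 0 0 = g 0 * integral {0..1} W"
  using J_nonneg[of g 0 0] by (simp add: circ_def)

end

section \<open>Product densities\<close>

text \<open>The factors of \<omega> depend on zw alone, so \<omega>(z, w) is a one-variable
  polynomial at zw, here given by its coefficients \<open>c\<close> and called \<open>om\<close>
  below. The second factor of the density is its value at z/w.\<close>

locale product_weight =
  fixes N :: nat and c :: "nat \<Rightarrow> real"
  assumes c0: "c 0 = 1"
    and nz: "norm s \<le> 1 \<Longrightarrow> (\<Sum>q\<le>N. complex_of_real (c q) * s ^ q) \<noteq> 0"
begin

definition om :: "complex \<Rightarrow> complex" where
  "om s = (\<Sum>q\<le>N. complex_of_real (c q) * s ^ q)"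

lemma om_nz: "norm s \<le> 1 \<Longrightarrow> om s \<noteq> 0"
  using nz by (simp add: om_def)

lemma om_circ_nz [simp]: "om (circ x) \<noteq> 0"
  by (rule om_nz) simp

lemma om_cnj: "om (cnj s) = cnj (om s)"
  by (simp add: om_def)

lemma om_0: "om 0 = 1"
  by (simp add: om_def c0 power_0_left if_distrib sum.delta cong: if_cong)

lemma om_holomorphic [holomorphic_intros]: "f holomorphic_on A \<Longrightarrow> (\<lambda>x. om (f x)) holomorphic_on A"
  unfolding om_def by (intro holomorphic_intros)

lemma om_cont [continuous_intros]: "continuous_on A f \<Longrightarrow> continuous_on A (\<lambda>x. om (f x))"
  unfolding om_def by (intro continuous_intros)

definition nm :: "real \<Rightarrow> real" where
  "nm x = (norm (om (circ x)))\<^sup>2"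

lemma nm_pos [simp]: "nm x > 0"
  by (simp add: nm_def)

lemma nm_nz [simp]: "nm x \<noteq> 0"
  using nm_pos[of x] by linarith

lemma nm_cont [continuous_intros]: "continuous_on A f \<Longrightarrow> continuous_on A (\<lambda>x. nm (f x))"
  unfolding nm_def by (intro continuous_intros)

lemma nm_minus: "nm (- x) = nm x"
  by (simp add: nm_def om_cnj flip: cnj_circ(1))

lemma circ_1_minus: "circ (1 - x) = circ (- x)"
  using circ_plus_1[of "- x"] by (simp add: add.commute)

lemma nm_reflect: "nm (1 - x) = nm x"
  using nm_minus[of x] by (simp add: nm_def circ_1_minus)

section \<open>Trigonometric moments and Szego polynomials on the circle\<close>

definition moment :: "int \<Rightarrow> real" where
  "moment b = integral {0..1} (\<lambda>x. Re (circ (of_int b * x)) / nm x)"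

text \<open>The weight is even, so reflection conjugates the integrand and the imaginary part
  cancels. Real moments allow real coefficients for T.\<close>

lemma integral_circ_nm: "integral {0..1} (\<lambda>x. circ (of_int b * x) / complex_of_real (nm x)) = complex_of_real (moment b)"
proof -
  define f where "f x = circ (of_int b * x) / complex_of_real (nm x)" for x
  have "continuous_on {0..1} f"
    unfolding f_def by (intro continuous_intros) auto
  then have f: "(f has_integral integral {0..1} f) {0..1}"
    using integrable_continuous_real by blast
  have "Re (integral {0..1} f) = moment b"
    using integral_unique[OF has_integral_Re[OF f]] by (simp add: moment_def f_def)
  moreover have "Im (integral {0..1} f) = 0"
  proof -
    have "Im (f (1 - x)) = - Im (f x)" for x
    proof -
      have "circ (of_int b * (1 - x)) = cnj (circ (of_int b * x))"
        by (simp only: circ_reflect cnj_circ) simp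
      then show ?thesis
        by (simp add: f_def nm_reflect)
    qed
    then have "integral {0..1} (\<lambda>x. Im (f x)) = - integral {0..1} (\<lambda>x. Im (f x))"
      using integral_reflect_01[of "\<lambda>x. Im (f x)"] by simp
    then show ?thesis
      using integral_unique[OF has_integral_Im[OF f]] by simp
  qed
  ultimately show ?thesis
    by (simp add: complex_eq_iff f_def[abs_def])
qed

text \<open>The Toeplitz form is the integral of the squared modulus of a polynomial against the
  positive weight \<open>1 / nm\<close>. If it were 0, the polynomial would vanish on the circle,
  hence all its Fourier coefficients.\<close>

lemma moment_pos_definite:
  assumes "\<exists>q\<in>{..D}. a q \<noteq> 0"
  shows "(\<Sum>q\<le>D. \<Sum>r\<le>D. a q * a r * moment (int q - int r)) > 0"
proof -
  define S where "S x = (\<Sum>q\<le>D. complex_of_real (a q) * circ x ^ q)" for x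
  have S_cont: "continuous_on A S" for A
    unfolding S_def by (intro continuous_intros)
  have circ_diff: "Re (circ (of_int (int q - int r) * x)) = Re (circ x ^ q * cnj (circ x ^ r))" for q r x
    unfolding circ_of_nat_mult[symmetric] cnj_circ circ_add[symmetric] by (simp add: algebra_simps)
  have "(norm (S x))\<^sup>2 = (\<Sum>q\<le>D. \<Sum>r\<le>D. a q * a r * Re (circ (of_int (int q - int r) * x)))" for x
  proof -
    have "(norm (S x))\<^sup>2 = Re (S x * cnj (S x))"
      by (simp only: complex_norm_square[symmetric]) simp
    also have "S x * cnj (S x) = (\<Sum>q\<le>D. \<Sum>r\<le>D. complex_of_real (a q * a r) * (circ x ^ q * cnj (circ x ^ r)))"
      unfolding S_def cnj_sum sum_product by (intro sum.cong refl) (simp add: mult_ac)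
    finally show ?thesis
      unfolding circ_diff by simp
  qed
  then have "integral {0..1} (\<lambda>x. (norm (S x))\<^sup>2 / nm x) =
      integral {0..1} (\<lambda>x. \<Sum>q\<le>D. \<Sum>r\<le>D. a q * a r * (Re (circ (of_int (int q - int r) * x)) / nm x))"
    by (simp add: sum_divide_distrib)
  also have "\<dots> = (\<Sum>q\<le>D. \<Sum>r\<le>D. a q * a r * moment (int q - int r))"
    unfolding moment_def
    by (subst integral_sum, simp, intro integrable_continuous_real continuous_intros, simp,
        intro sum.cong refl, subst integral_sum, simp, intro integrable_continuous_real continuous_intros, simp,
        intro sum.cong refl integral_mult_right)
  finally have eq: "(\<Sum>q\<le>D. \<Sum>r\<le>D. a q * a r * moment (int q - int r)) = integral {0..1} (\<lambda>x. (norm (S x))\<^sup>2 / nm x)" ..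
  have cont: "continuous_on {0..1} (\<lambda>x. (norm (S x))\<^sup>2 / nm x)"
    by (intro continuous_intros S_cont) simp
  have nonneg: "(norm (S x))\<^sup>2 / nm x \<ge> 0" for x
    using nm_pos[of x] by (intro divide_nonneg_pos) auto
  have "integral {0..1} (\<lambda>x. (norm (S x))\<^sup>2 / nm x) \<noteq> 0"
  proof
    assume "integral {0..1} (\<lambda>x. (norm (S x))\<^sup>2 / nm x) = 0"
    then have S0: "S x = 0" if "x \<in> {0..1}" for x
      using integral_eq_0_iff[OF cont _ nonneg] that by auto
    have "a q = 0" if "q \<le> D" for q
    proof -
      have "0 = integral {0..1} (\<lambda>x. circ (of_int (- int q) * x) * S x)"
        using S0 by (subst integral_cong[where g = "\<lambda>_. 0"]) auto
      also have "\<dots> = integral {0..1} (\<lambda>x. \<Sum>r\<le>D. complex_of_real (a r) * circ (of_int (int r - int q) * x))"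
      proof (intro integral_cong)
        fix x
        have "circ (of_int (int r - int q) * x) = circ (of_int (- int q) * x) * circ x ^ r" for r
          unfolding circ_of_nat_mult[symmetric] circ_add[symmetric] by (simp add: algebra_simps)
        then show "circ (of_int (- int q) * x) * S x = (\<Sum>r\<le>D. complex_of_real (a r) * circ (of_int (int r - int q) * x))"
          by (simp only: S_def sum_distrib_left mult_ac)
      qed
      also have "\<dots> = (\<Sum>r\<le>D. complex_of_real (a r) * integral {0..1} (\<lambda>x. circ (of_int (int r - int q) * x)))"
        by (subst integral_sum, simp, intro integrable_continuous_real continuous_intros)
           (simp only: integral_mult_right)
      also have "\<dots> = (\<Sum>r\<le>D. if r = q then complex_of_real (a r) else 0)"
        unfolding integral_circ_int by (intro sum.cong) auto
      also have "\<dots> = complex_of_real (a q)"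
        using that by simp
      finally show ?thesis by simp
    qed
    with assms show False by auto
  qed
  moreover have "integral {0..1} (\<lambda>x. (norm (S x))\<^sup>2 / nm x) \<ge> 0"
    by (intro integral_nonneg integrable_continuous_real cont nonneg)
  ultimately show ?thesis
    unfolding eq by simp
qed

definition szego_weight :: "nat \<Rightarrow> (nat \<Rightarrow> real) \<Rightarrow> real \<Rightarrow> complex" where
  "szego_weight K t x = (\<Sum>r\<le>K. complex_of_real (t r) * circ x ^ r) / complex_of_real (nm x)"

text \<open>If \<open>D \<ge> N\<close>, then T = \<open>om\<close> itself works; otherwise T solves
  the Toeplitz system of size \<open>D + 1\<close>. The bound \<open>K \<le> N\<close> limits the
  length of the family in x, and \<open>K \<le> D\<close> limits its degree in y.\<close>

lemma szego_polynomial_exists: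
  "\<exists>K t. K \<le> N \<and> K \<le> D \<and> t 0 > 0 \<and>
     (\<forall>r\<le>D. integral {0..1} (\<lambda>x. circ (of_int (- int r) * x) * szego_weight K t x) =
       (if r = 0 then complex_of_real (1 / t 0) else 0))"
proof (cases "D < N")
  case True
  define Q where "Q q r = moment (int q - int r)" for q r :: nat
  have "\<exists>a. \<forall>r\<in>{..D}. (\<Sum>q\<le>D. a q * Q q r) = (if r = 0 then 1 else 0)"
    by (rule gram_system_solvable) (simp_all only: finite_atMost Q_def moment_pos_definite)
  then obtain a where a: "\<And>r. r \<le> D \<Longrightarrow> (\<Sum>q\<le>D. a q * Q q r) = (if r = 0 then 1 else 0)"
    by (meson atMost_iff)
  have "(\<Sum>q\<le>D. \<Sum>r\<le>D. a q * a r * Q q r) = (\<Sum>r\<le>D. a r * (\<Sum>q\<le>D. a q * Q q r))"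
    by (subst sum.swap) (simp add: sum_distrib_left mult_ac)
  also have "\<dots> = (\<Sum>r\<le>D. if r = 0 then a 0 else 0)"
    by (intro sum.cong) (auto simp: a)
  also have "\<dots> = a 0"
    by simp
  finally have a00: "(\<Sum>q\<le>D. \<Sum>r\<le>D. a q * a r * Q q r) = a 0" .
  have "\<exists>q\<in>{..D}. a q \<noteq> 0"
  proof (rule ccontr)
    assume "\<not> (\<exists>q\<in>{..D}. a q \<noteq> 0)"
    then have "(\<Sum>q\<le>D. a q * Q q 0) = 0"
      by (intro sum.neutral) simp
    then show False
      using a[of 0] by simp
  qed
  from moment_pos_definite[OF this] have a0: "a 0 > 0"
    using a00 by (simp add: Q_def)
  \<comment> \<open>With this scaling \<open>t 0 = sqrt (a 0)\<close>, and the moment of order 0 is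
    \<open>1 / sqrt (a 0)\<close>, the reciprocal of \<open>t 0\<close>.\<close>
  define t where "t q = a q / sqrt (a 0)" for q
  have "integral {0..1} (\<lambda>x. circ (of_int (- int r) * x) * szego_weight D t x) =
       (if r = 0 then complex_of_real (1 / t 0) else 0)" if "r \<le> D" for r
  proof -
    have "circ (of_int (- int r) * x) * szego_weight D t x =
        (\<Sum>q\<le>D. complex_of_real (t q) * (circ (of_int (int q - int r) * x) / complex_of_real (nm x)))" for x
    proof -
      have "circ (of_int (int q - int r) * x) = circ (of_int (- int r) * x) * circ x ^ q" for q
        unfolding circ_of_nat_mult[symmetric] circ_add[symmetric] by (simp add: algebra_simps)
      then show ?thesis
        by (simp add: szego_weight_def sum_distrib_left sum_divide_distrib mult_ac)
    qed
    then have "integral {0..1} (\<lambda>x. circ (of_int (- int r) * x) * szego_weight D t x) =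
        integral {0..1} (\<lambda>x. \<Sum>q\<le>D. complex_of_real (t q) * (circ (of_int (int q - int r) * x) / complex_of_real (nm x)))"
      by (simp only:)
    also have "\<dots> = (\<Sum>q\<le>D. complex_of_real (t q) * complex_of_real (moment (int q - int r)))"
      by (subst integral_sum, simp, intro integrable_continuous_real continuous_intros, simp)
         (simp only: integral_mult_right integral_circ_nm)
    also have "\<dots> = complex_of_real ((\<Sum>q\<le>D. a q * Q q r) / sqrt (a 0))"
      by (simp add: Q_def t_def sum_divide_distrib)
    finally show ?thesis
      using a0 by (simp add: a[OF that] t_def real_div_sqrt)
  qed
  moreover have "t 0 > 0"
    using a0 by (simp add: t_def)
  ultimately show ?thesis
    using True by (intro exI[of _ D] exI[of _ t]) auto
next
  case False
  have "integral {0..1} (\<lambda>x. circ (of_int (- int r) * x) * szego_weight N c x) =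
       (if r = 0 then complex_of_real (1 / c 0) else 0)" for r
  proof -
    define f where "f x = circ (of_int (- int r) * x) * szego_weight N c x" for x
    \<comment> \<open>For T = \<open>om\<close> the kernel is the reciprocal of the conjugate of
      \<open>om\<close>. Reflection conjugates u and makes it analytic in the disc.\<close>
    have "f (1 - x) = circ x ^ r / om (circ x)" for x
    proof -
      have "circ (of_int (- int r) * (1 - x)) = circ x ^ r"
        by (simp only: circ_reflect) (simp add: circ_of_nat_mult)
      moreover have "szego_weight N c (1 - x) = cnj (om (circ x)) / complex_of_real (nm x)"
        by (simp only: szego_weight_def nm_reflect circ_1_minus om_def[symmetric] cnj_circ(1)[symmetric] om_cnj)
      moreover have "complex_of_real (nm x) = om (circ x) * cnj (om (circ x))"
        unfolding nm_def by (rule complex_norm_square)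
      ultimately show ?thesis
        by (simp add: f_def)
    qed
    then have "integral {0..1} f = integral {0..1} (\<lambda>x. circ x ^ r / om (circ x))"
      using integral_reflect_01[of f] by simp
    also have "(\<lambda>z. z ^ r / om z) holomorphic_on cball 0 1"
      by (intro holomorphic_intros) (simp add: om_nz)
    from integral_unique[OF mean_value_circle[OF this]]
    have "integral {0..1} (\<lambda>x. circ x ^ r / om (circ x)) = (if r = 0 then complex_of_real (1 / c 0) else 0)"
      by (simp add: om_0 c0 power_0_left)
    finally show ?thesis
      by (simp add: f_def[abs_def])
  qed
  then show ?thesis
    using False c0 by (intro exI[of _ N] exI[of _ c]) auto
qed

abbreviation dens :: "real \<Rightarrow> real \<Rightarrow> real" where
  "dens x y \<equiv> (norm (om (circle_pt x * circle_pt y) * om (circle_pt x * cnj (circle_pt y))))\<^sup>2"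

sublocale chebyshev_weight dens
proof
  show "continuous_on ({-1..1} \<times> {-1..1}) (\<lambda>(x, y). dens x y)"
    unfolding case_prod_beta by (intro continuous_intros)
  show "dens x y > 0" if "-1 \<le> x" "x \<le> 1" "-1 \<le> y" "y \<le> 1" for x y
  proof -
    have "norm (circle_pt x) = 1" "norm (circle_pt y) = 1"
      using that by (auto intro!: norm_circle_pt)
    then have "om (circle_pt x * circle_pt y) \<noteq> 0" "om (circle_pt x * cnj (circle_pt y)) \<noteq> 0"
      by (auto intro!: om_nz simp: norm_mult)
    then show ?thesis by simp
  qed
qed

lemma norm_om_cnj: "norm (om (cnj s)) = norm (om s)"
  by (simp add: om_cnj)

lemma dens_sym: "dens x y = dens y x"
proof -
  have "circle_pt y * cnj (circle_pt x) = cnj (circle_pt x * cnj (circle_pt y))"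
    by simp
  then have "norm (om (circle_pt y * cnj (circle_pt x))) = norm (om (circle_pt x * cnj (circle_pt y)))"
    using norm_om_cnj by metis
  then show ?thesis
    by (simp add: norm_mult mult.commute[of "circle_pt y" "circle_pt x"])
qed

text \<open>\<open>circle_pt\<close> recovers the point from its cosine only up to conjugation;
  conjugating either argument at most swaps the two factors in modulus.\<close>

lemma dens_cos: "dens (cos (2 * pi * s)) (cos (2 * pi * t)) = nm (s + t) * nm (t - s)"
proof -
  define z where "z = circ s"
  define w where "w = circ t"
  define R where "R u v = norm (om (u * v)) * norm (om (u * cnj v))" for u v
  have sym: "R (cnj u) v = R u v" "R u (cnj v) = R u v" for u v
  proof -
    have "norm (om (cnj u * v)) = norm (om (u * cnj v))"
      using norm_om_cnj[of "u * cnj v"] by simp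
    moreover have "norm (om (cnj u * cnj v)) = norm (om (u * v))"
      using norm_om_cnj[of "u * v"] by simp
    ultimately show "R (cnj u) v = R u v"
      by (simp add: R_def)
    show "R u (cnj v) = R u v"
      by (simp add: R_def)
  qed
  have "circle_pt (cos (2 * pi * s)) = z \<or> circle_pt (cos (2 * pi * s)) = cnj z"
    using circle_pt_cos[of "2 * pi * s"] by (simp add: z_def circ_def)
  moreover have "circle_pt (cos (2 * pi * t)) = w \<or> circle_pt (cos (2 * pi * t)) = cnj w"
    using circle_pt_cos[of "2 * pi * t"] by (simp add: w_def circ_def)
  ultimately have "R (circle_pt (cos (2 * pi * s))) (circle_pt (cos (2 * pi * t))) = R z w"
    using sym by metis
  moreover have "norm (om (z * cnj w)) = norm (om (circ (t - s)))"
    using norm_om_cnj[of "z * cnj w"] by (simp add: z_def w_def cnj_circ(1) mult.commute flip: circ_add)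
  moreover have "z * w = circ (s + t)"
    by (simp add: z_def w_def circ_add)
  ultimately show ?thesis
    by (simp add: R_def nm_def norm_mult power_mult_distrib)
qed

end

section \<open>The Chebyshev family attached to one index l\<close>

locale szego_family = product_weight +
  fixes K D l :: nat and t :: "nat \<Rightarrow> real"
  assumes K_le_N: "K \<le> N" and K_le_D: "K \<le> D" and t0: "t 0 > 0"
    and moments: "r \<le> D \<Longrightarrow> integral {0..1} (\<lambda>x. circ (of_int (- int r) * x) * szego_weight K t x) =
       (if r = 0 then complex_of_real (1 / t 0) else 0)"
begin

text \<open>The product of \<omega>(1/z, 1/w) and T(w/z) has terms \<open>c q * t r\<close> z^(-q-r)
  w^(r-q). They are grouped by the power of 1/z, and after the factor w^(l+1) each power of w
  becomes a \<open>ucheb\<close> in y.\<close>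

definition g :: "nat \<Rightarrow> real poly" where
  "g i = (\<Sum>q\<le>N. \<Sum>r\<le>K. if q + r = i then smult (c q * t r) (ucheb (int l + 1 - int q + int r)) else 0)"

abbreviation F :: "int \<Rightarrow> real poly poly" where
  "F a \<equiv> cheb_family g (N + K) a"

lemma eval2_F: "eval2 (F a) x y = (\<Sum>q\<le>N. \<Sum>r\<le>K.
    c q * t r * (poly (ucheb (a - int q - int r)) x * poly (ucheb (int l + 1 - int q + int r)) y))"
proof -
  have "eval2 (F a) x y = (\<Sum>i\<le>N + K. \<Sum>q\<le>N. \<Sum>r\<le>K.
      if i = q + r then c q * t r * (poly (ucheb (a - int q - int r)) x * poly (ucheb (int l + 1 - int q + int r)) y) else 0)"
    unfolding eval2_cheb_family g_def poly_sum sum_distrib_right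
    by (intro sum.cong refl) (auto simp: algebra_simps)
  also have "\<dots> = (\<Sum>q\<le>N. \<Sum>r\<le>K. \<Sum>i\<le>N + K.
      if i = q + r then c q * t r * (poly (ucheb (a - int q - int r)) x * poly (ucheb (int l + 1 - int q + int r)) y) else 0)"
    by (subst sum.swap) (intro sum.cong refl sum.swap)
  also have "\<dots> = (\<Sum>q\<le>N. \<Sum>r\<le>K.
    c q * t r * (poly (ucheb (a - int q - int r)) x * poly (ucheb (int l + 1 - int q + int r)) y))"
    by (intro sum.cong refl) (simp add: add_mono)
  finally show ?thesis .
qed

abbreviation W :: "real \<Rightarrow> complex" where
  "W \<equiv> szego_weight K t"

sublocale torus_kernel W D
proof
  show "continuous_on UNIV W"
    unfolding szego_weight_def by (intro continuous_intros) auto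
  show "W (x + 1) = W x" for x
    by (simp add: szego_weight_def nm_def)
  show "integral {0..1} (\<lambda>x. circ (of_int (- int r) * x) * W x) = 0" if "1 \<le> r" "r \<le> D" for r
    using moments[of r] that by simp
qed

lemma integral_W: "integral {0..1} W = complex_of_real (1 / t 0)"
  using moments[of 0] by (simp add: circ_def)

text \<open>The product before antisymmetrization. On the torus the conjugate of
  \<open>om (circ (s + u))\<close> is \<omega>(1/z, 1/w).\<close>

definition G :: "int \<Rightarrow> real \<Rightarrow> real \<Rightarrow> complex" where
  "G a s u = circ (of_int a * s) * circ (of_int (int l + 1) * u) * cnj (om (circ (s + u)))
    * (\<Sum>r\<le>K. complex_of_real (t r) * circ (u - s) ^ r)"

lemma G_expand: "G a s u = (\<Sum>q\<le>N. \<Sum>r\<le>K. complex_of_real (c q * t r) *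
    circ (of_int (a - int q - int r) * s + of_int (int l + 1 - int q + int r) * u))"
proof -
  have "circ (of_int a * s) * circ (of_int (int l + 1) * u) * cnj (circ (s + u)) ^ q * circ (u - s) ^ r =
      circ (of_int (a - int q - int r) * s + of_int (int l + 1 - int q + int r) * u)" for q r
    unfolding circ_of_nat_mult[symmetric] cnj_circ circ_add[symmetric] by (simp add: algebra_simps)
  note e = this[symmetric]
  show ?thesis
    unfolding e G_def om_def cnj_sum
    by (simp add: sum_distrib_left sum_distrib_right mult_ac)
qed

text \<open>A product of two sines is a difference of cosines of the sum and the difference of the
  angles; the difference belongs to \<open>- u\<close>. Real parts thus replace two of the four
  terms of the antisymmetrization.\<close>

lemma eval2_F_sin:
  "eval2 (F a) (cos (2 * pi * s)) (cos (2 * pi * u)) * sin (2 * pi * s) * sin (2 * pi * u) =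
    - (1 / 2) * (Re (G a s u) - Re (G a s (- u)))"
proof -
  have sin_sin: "sin A * sin B = - (1 / 2) * (cos (A + B) - cos (A - B))" for A B :: real
    by (simp add: cos_add cos_diff)
  have "eval2 (F a) (cos (2 * pi * s)) (cos (2 * pi * u)) * sin (2 * pi * s) * sin (2 * pi * u) =
      (\<Sum>q\<le>N. \<Sum>r\<le>K. c q * t r * (sin (of_int (a - int q - int r) * (2 * pi * s)) *
        sin (of_int (int l + 1 - int q + int r) * (2 * pi * u))))"
    unfolding eval2_F sum_distrib_right ucheb_cos[symmetric] by (simp only: mult_ac)
  also have "\<dots> = (\<Sum>q\<le>N. \<Sum>r\<le>K. - (1 / 2) * (c q * t r *
        (Re (circ (of_int (a - int q - int r) * s + of_int (int l + 1 - int q + int r) * u))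
         - Re (circ (of_int (a - int q - int r) * s + of_int (int l + 1 - int q + int r) * (- u))))))"
    unfolding sin_sin by (intro sum.cong refl) (simp add: circ_def algebra_simps)
  also have "\<dots> = - (1 / 2) * (Re (G a s u) - Re (G a s (- u)))"
    unfolding G_expand by (simp add: sum_distrib_left sum_subtractf right_diff_distrib sum_negf)
  finally show ?thesis .
qed

lemma nm_plus_1: "nm (x + 1) = nm x"
  by (simp add: nm_def)

definition E :: "nat \<Rightarrow> nat \<Rightarrow> real \<Rightarrow> real \<Rightarrow> real" where
  "E i j s u = (cos (2 * pi * s) ^ i * sin (2 * pi * s)) * (cos (2 * pi * u) ^ j * sin (2 * pi * u)) / (nm (s + u) * nm (u - s))"

lemma E_reflect: "E i j s (1 - u) = - E i j s u" "E i j s (- u) = - E i j s u"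
proof -
  have minus: "E i j s (- u) = - E i j s u" for u
  proof -
    have "s + - u = - (u - s)" "- u - s = - (s + u)"
      by simp_all
    then have "nm (s + - u) = nm (u - s)" "nm (- u - s) = nm (s + u)"
      by (simp_all only: nm_minus)
    then show ?thesis
      unfolding E_def by simp
  qed
  then show "E i j s (- u) = - E i j s u" .
  have "nm (s + (1 - u)) = nm (s - u)" "nm (1 - u - s) = nm (- u - s)"
    using nm_plus_1[of "s - u"] nm_plus_1[of "- u - s"] by (simp_all add: algebra_simps)
  moreover have "cos (2 * pi * (1 - u)) = cos (2 * pi * u)" "sin (2 * pi * (1 - u)) = - sin (2 * pi * u)"
    by (simp_all add: cos_diff sin_diff right_diff_distrib)
  ultimately have "E i j s (1 - u) = E i j s (- u)"
    by (simp add: E_def)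
  then show "E i j s (1 - u) = - E i j s u"
    using minus by simp
qed

lemma G_cont [continuous_intros]: "continuous_on A f \<Longrightarrow> continuous_on A h \<Longrightarrow> continuous_on A (\<lambda>p. G a (f p) (h p))"
  unfolding G_def by (intro continuous_intros)

lemma E_cont [continuous_intros]:
  fixes A :: "(real \<times> real) set"
  shows "continuous_on A f \<Longrightarrow> continuous_on A h \<Longrightarrow> continuous_on A (\<lambda>p. E i j (f p) (h p))"
  unfolding E_def by (intro continuous_intros) auto

lemma G_reflect: "G a s (- (1 - u)) = G a s u"
proof -
  have "circ (of_int (int l + 1) * (- (1 - u))) = circ (of_int (int l + 1) * u)"
    using circ_int_mult_plus_1[of "int l + 1" "u - 1"] by (simp add: algebra_simps)
  moreover have "circ (s + - (1 - u)) = circ (s + u)" "circ (- (1 - u) - s) = circ (u - s)"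
    using circ_plus_1[of "s + u - 1"] circ_plus_1[of "u - s - 1"] by (simp_all add: algebra_simps)
  ultimately show ?thesis
    by (simp only: G_def)
qed

text \<open>\<open>E\<close> is odd in \<open>u\<close>, so the reflected half of the
  antisymmetrization contributes as much as the other one: \<open>4\<close> from the torus formula,
  times \<open>- 1 / 2\<close>, times 2.\<close>

lemma L_F_torus: "L (F a * monom2 i j) = - 4 * torus_integral (\<lambda>s u. Re (G a s u) * E i j s u)"
proof -
  let ?f = "\<lambda>s u. Re (G a s u) * E i j s u"
  let ?f' = "\<lambda>s u. Re (G a s (- u)) * E i j s u"
  have cont: "continuous_on A (\<lambda>p. ?f (fst p) (snd p))" "continuous_on A (\<lambda>p. ?f' (fst p) (snd p))" for A
    by (intro continuous_intros)+
  have refl: "integral {0..1} (\<lambda>u. ?f' s u) = - integral {0..1} (\<lambda>u. ?f s u)" for s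
  proof -
    have "integral {0..1} (\<lambda>u. ?f' s u) = integral {0..1} (\<lambda>u. ?f' s (1 - u))"
      by (rule integral_reflect_01[symmetric])
    then show ?thesis
      by (simp only: G_reflect E_reflect) simp
  qed
  have "L (F a * monom2 i j) = 4 * integral {0..1} (\<lambda>s. integral {0..1} (\<lambda>u. - (1 / 2) * (?f s u - ?f' s u)))"
  proof -
    have "eval2 (F a * monom2 i j) (cos (2 * pi * s)) (cos (2 * pi * u)) / dens (cos (2 * pi * s)) (cos (2 * pi * u))
      * (sin (2 * pi * s))\<^sup>2 * (sin (2 * pi * u))\<^sup>2 =
      (eval2 (F a) (cos (2 * pi * s)) (cos (2 * pi * u)) * sin (2 * pi * s) * sin (2 * pi * u)) * E i j s u" for s u
      unfolding dens_cos by (simp add: eval2_mult eval2_monom2 E_def power2_eq_square)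
    then have "eval2 (F a * monom2 i j) (cos (2 * pi * s)) (cos (2 * pi * u)) / dens (cos (2 * pi * s)) (cos (2 * pi * u))
      * (sin (2 * pi * s))\<^sup>2 * (sin (2 * pi * u))\<^sup>2 = - (1 / 2) * (?f s u - ?f' s u)" for s u
      unfolding eval2_F_sin by (simp add: left_diff_distrib)
    then show ?thesis
      unfolding L_alt weighted_measure_torus[OF continuous_on_eval2] by simp
  qed
  also have "\<dots> = - 2 * torus_integral (\<lambda>s u. ?f s u - ?f' s u)"
  proof -
    have "continuous_on UNIV (\<lambda>p. ?f (fst p) (snd p) - ?f' (fst p) (snd p))"
      by (intro continuous_on_diff cont)
    note it = torus_integral_iterated(1)[where f = "\<lambda>s u. ?f s u - ?f' s u", OF this]
    show ?thesis
      unfolding it integral_mult_right by simp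
  qed
  also have "torus_integral (\<lambda>s u. ?f s u - ?f' s u) = torus_integral ?f - torus_integral ?f'"
    by (intro integral_diff integrable_continuous cont)
  also have "torus_integral ?f' = - torus_integral ?f"
    unfolding torus_integral_iterated(1)[where f = ?f, OF cont(1)]
      torus_integral_iterated(1)[where f = ?f', OF cont(2)] refl integral_neg ..
  finally show ?thesis by simp
qed

text \<open>Numerator of cos^i sin written in z, kept as a polynomial so that the integrand expands
  into monomials z^e w^e' to which \<open>J\<close> applies.\<close>

abbreviation P :: "nat \<Rightarrow> complex poly" where
  "P i \<equiv> [:1, 0, 1:] ^ i * [:-1, 0, 1:]"

lemma poly_P: "poly (P i) z = (z\<^sup>2 + 1) ^ i * (z\<^sup>2 - 1)"
  by (simp add: power2_eq_square algebra_simps)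

lemma coeff_P_0: "coeff (P i) 0 = - 1"
  by (simp add: coeff_mult_0 flip: poly_0_coeff_0)

lemma cos_power_sin_P:
  "complex_of_real (cos (2 * pi * s) ^ i * sin (2 * pi * s)) = circ (of_int (- int (Suc i)) * s) * poly (P i) (circ s) / (2 ^ i * (2 * \<i>))"
proof -
  have "circ (of_int (- int (Suc i)) * s) * circ s ^ Suc i = 1"
    unfolding circ_of_nat_mult[symmetric] circ_add[symmetric] by (simp add: circ_def algebra_simps)
  then have "complex_of_real (cos (2 * pi * s) ^ i * sin (2 * pi * s)) =
      circ (of_int (- int (Suc i)) * s) * (circ s ^ Suc i * complex_of_real (cos (2 * pi * s) ^ i * sin (2 * pi * s)))"
    by (simp only: mult.assoc[symmetric]) simp
  then show ?thesis
    unfolding cos_power_sin_circ poly_P by simp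
qed

lemma inverse_om_holomorphic: "(\<lambda>z. 1 / om z) holomorphic_on cball 0 1"
  by (intro holomorphic_intros) (simp add: om_nz)

text \<open>The conjugate of \<open>om\<close> over \<open>nm (s + u)\<close> leaves
  \<open>1 / om\<close>, analytic in zw. The two denominators \<open>2 * \<i>\<close> multiply to
  \<open>- 4\<close> and cancel the constant in front; the exponents \<open>n + 1\<close> and
  \<open>l + 1\<close> drop to \<open>n - i\<close> and \<open>l - j\<close>.\<close>

lemma GE_expand:
  "- 4 * (G (int n + 1) s u * complex_of_real (E i j s u)) =
    (\<Sum>e\<le>degree (P i). \<Sum>e'\<le>degree (P j). coeff (P i) e * coeff (P j) e' / 2 ^ (i + j) *
      (circ (of_int (int n - int i + int e) * s + of_int (int l - int j + int e') * u) * (1 / om (circ (s + u))) * W (u - s)))"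
proof -
  have nm1: "complex_of_real (nm (s + u)) = om (circ (s + u)) * cnj (om (circ (s + u)))"
    unfolding nm_def by (rule complex_norm_square)
  define T where "T = (\<Sum>r\<le>K. complex_of_real (t r) * circ (u - s) ^ r)"
  have W: "W (u - s) = T / complex_of_real (nm (u - s))"
    by (simp add: szego_weight_def T_def)
  have E: "complex_of_real (E i j s u) = complex_of_real (cos (2 * pi * s) ^ i * sin (2 * pi * s)) *
      complex_of_real (cos (2 * pi * u) ^ j * sin (2 * pi * u)) / (complex_of_real (nm (s + u)) * complex_of_real (nm (u - s)))"
    by (simp add: E_def)
  have "G (int n + 1) s u * complex_of_real (E i j s u) =
      circ (of_int (int n + 1) * s) * circ (of_int (int l + 1) * u) * (1 / om (circ (s + u))) * W (u - s) *
      (complex_of_real (cos (2 * pi * s) ^ i * sin (2 * pi * s)) * complex_of_real (cos (2 * pi * u) ^ j * sin (2 * pi * u)))"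
    unfolding E G_def T_def[symmetric] W nm1 by (simp add: field_simps)
  also have "\<dots> = (circ (of_int (int n + 1) * s) * circ (of_int (- int (Suc i)) * s)) *
      (circ (of_int (int l + 1) * u) * circ (of_int (- int (Suc j)) * u)) *
      (1 / om (circ (s + u))) * W (u - s) * poly (P i) (circ s) * poly (P j) (circ u) / (2 ^ (i + j) * (2 * \<i>)\<^sup>2)"
    unfolding cos_power_sin_P by (simp only: times_divide_eq_left times_divide_eq_right divide_divide_eq_left power_add power2_eq_square mult_ac)
  also have "(2 * \<i>)\<^sup>2 = - 4"
    by (simp add: power_mult_distrib)
  also have "circ (of_int (int n + 1) * s) * circ (of_int (- int (Suc i)) * s) = circ (of_int (int n - int i) * s)"
    unfolding circ_add[symmetric] by (simp add: algebra_simps)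
  also have "circ (of_int (int l + 1) * u) * circ (of_int (- int (Suc j)) * u) = circ (of_int (int l - int j) * u)"
    unfolding circ_add[symmetric] by (simp add: algebra_simps)
  finally have "- 4 * (G (int n + 1) s u * complex_of_real (E i j s u)) =
      circ (of_int (int n - int i) * s) * circ (of_int (int l - int j) * u) * (1 / om (circ (s + u))) * W (u - s)
      * poly (P i) (circ s) * poly (P j) (circ u) / 2 ^ (i + j)"
    by simp
  moreover have "circ (of_int (int n - int i + int e) * s + of_int (int l - int j + int e') * u) =
      circ (of_int (int n - int i) * s) * circ (of_int (int l - int j) * u) * (circ s ^ e * circ u ^ e')" for e e'
    unfolding circ_of_nat_mult[symmetric] circ_add[symmetric] by (simp add: algebra_simps)
  ultimately show ?thesis
    unfolding poly_altdef by (simp add: sum_distrib_left sum_distrib_right sum_divide_distrib mult_ac del: mult_pCons_left mult_pCons_right)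
qed

text \<open>The exponents are \<open>n - i + e \<ge> 0\<close> and
  \<open>l - j + e' \<ge> - D\<close>, the range of \<open>J_eq_0\<close>. Both vanish only for
  \<open>e = e' = 0\<close>, \<open>i = n\<close> and \<open>j = l\<close>, where the two constant
  coefficients \<open>- 1\<close> cancel in sign.\<close>

lemma L_F:
  assumes "i \<le> n" "j \<le> l + D" "i = n \<Longrightarrow> j \<le> l"
  shows "L (F (int n + 1) * monom2 i j) = (if i = n \<and> j = l then 1 / (2 ^ (n + l) * t 0) else 0)"
proof -
  define rec_om where "rec_om z = 1 / om z" for z
  have rec_om: "rec_om holomorphic_on cball 0 1"
    using inverse_om_holomorphic by (simp add: rec_om_def[abs_def])
  let ?c = "\<lambda>e e'. coeff (P i) e * coeff (P j) e' / 2 ^ (i + j)"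
  define Z where "Z = torus_integral (\<lambda>s u. - 4 * (G (int n + 1) s u * complex_of_real (E i j s u)))"
  have "((\<lambda>p. - 4 * (G (int n + 1) (fst p) (snd p) * complex_of_real (E i j (fst p) (snd p)))) has_integral Z) (cbox (0, 0) (1, 1))"
    unfolding Z_def by (intro integrable_integral integrable_continuous continuous_intros)
  from integral_unique[OF has_integral_Re[OF this]]
  have "L (F (int n + 1) * monom2 i j) = Re Z"
    unfolding L_F_torus by simp
  have "Z = (\<Sum>e\<le>degree (P i). \<Sum>e'\<le>degree (P j). ?c e e' * J rec_om (int n - int i + int e) (int l - int j + int e'))"
  proof -
    have "((\<lambda>p. circ (of_int a * fst p + of_int b * snd p) * rec_om (circ (fst p + snd p)) * W (snd p - fst p))
        has_integral J rec_om a b) (cbox (0, 0) (1, 1))" for a b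
      unfolding J_def by (rule integrable_integral[OF integrable_continuous[OF J_integrand_cont[OF rec_om]]])
    then have "((\<lambda>p. \<Sum>e\<le>degree (P i). \<Sum>e'\<le>degree (P j). ?c e e' *
        (circ (of_int (int n - int i + int e) * fst p + of_int (int l - int j + int e') * snd p)
          * rec_om (circ (fst p + snd p)) * W (snd p - fst p))) has_integral
      (\<Sum>e\<le>degree (P i). \<Sum>e'\<le>degree (P j). ?c e e' * J rec_om (int n - int i + int e) (int l - int j + int e')))
      (cbox (0, 0) (1, 1))"
      by (intro has_integral_sum finite_atMost has_integral_mult_right)
    from integral_unique[OF this] show ?thesis
      unfolding Z_def GE_expand rec_om_def .
  qed
  also have "\<dots> = (\<Sum>e\<le>degree (P i). \<Sum>e'\<le>degree (P j).
      if e' = 0 then (if e = 0 then (if i = n \<and> j = l then 1 / (2 ^ (n + l) * complex_of_real (t 0)) else 0) else 0) else 0)"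
  proof (intro sum.cong refl)
    fix e e'
    show "?c e e' * J rec_om (int n - int i + int e) (int l - int j + int e') =
        (if e' = 0 then (if e = 0 then (if i = n \<and> j = l then 1 / (2 ^ (n + l) * complex_of_real (t 0)) else 0) else 0) else 0)"
    proof (cases "e' = 0 \<and> e = 0 \<and> i = n \<and> j = l")
      case True
      have "J rec_om 0 0 = complex_of_real (1 / t 0)"
        using J_0_0[OF rec_om] by (simp add: rec_om_def om_0 integral_W)
      then show ?thesis
        using True by (simp add: coeff_P_0 del: mult_pCons_left mult_pCons_right)
    next
      case False
      have "J rec_om (int n - int i + int e) (int l - int j + int e') = 0"
        by (rule J_eq_0[OF rec_om]) (use assms False in auto)
      then show ?thesis
        using False by auto
    qed
  qed
  also have "\<dots> = (if i = n \<and> j = l then 1 / (2 ^ (n + l) * complex_of_real (t 0)) else 0)"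
    by simp
  finally have "Z = complex_of_real (if i = n \<and> j = l then 1 / (2 ^ (n + l) * t 0) else 0)"
    by simp
  then show ?thesis
    using \<open>L (F (int n + 1) * monom2 i j) = Re Z\<close> by simp
qed

text \<open>The index \<open>l + 1 - q + r\<close> is at most \<open>m + 1\<close> because
  \<open>r \<le> K \<le> D = m - l\<close>, and at least \<open>- m\<close> because
  \<open>q \<le> N \<le> m\<close>.\<close>

lemma g_degree:
  assumes "l + D = m" "N \<le> m"
  shows "degree (g i) \<le> m"
  unfolding g_def
proof (intro degree_sum_le)
  fix q r assume "q \<in> {..N}" "r \<in> {..K}"
  then have "degree (ucheb (int l + 1 - int q + int r) :: real poly) \<le> m"
    using assms K_le_D by (intro degree_ucheb_le) auto
  then show "degree (if q + r = i then smult (c q * t r) (ucheb (int l + 1 - int q + int r)) else 0) \<le> m"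
    by (auto intro: order_trans[OF degree_smult_le])
qed auto

lemma g_0: "g 0 = smult (t 0) (ucheb (int l + 1))"
proof -
  have "g 0 = (\<Sum>q\<le>N. if q = 0 then (\<Sum>r\<le>K. if r = 0 then smult (t 0) (ucheb (int l + 1)) else 0) else 0)"
    unfolding g_def by (intro sum.cong refl) (auto simp: c0 intro!: sum.cong)
  then show ?thesis by simp
qed

text \<open>The family has length \<open>N + K \<le> 2 * N\<close>, whence \<open>N < n\<close>. The
  factor \<open>t 0\<close> in the leading coefficient cancels the \<open>1 / t 0\<close> of
  \<open>L_F\<close>.\<close>

lemma szego_entries:
  assumes m: "l + D = m" "N \<le> m" and n: "N < n" and k: "k \<le> m"
  shows "A_entry n m k l = (if k = l then 1 / 2 else 0)" and "B_entry n m k l = 0"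
proof -
  have g0: "degree (g 0) \<le> l" "coeff (g 0) l = 2 ^ l * t 0"
    using degree_ucheb_le[of "int l + 1" l, where 'a = real] t0
    by (simp_all add: g_0 coeff_ucheb_lead)
  have orth: "L (F (int \<nu> + 1) * monom2 i j) = 0" if "(i, j) \<in> lex_less \<nu> m l" for \<nu> i j
    using that L_F[of i \<nu> j] m by (auto simp: lex_less_def)
  have norm: "2 ^ \<nu> * coeff (g 0) l * L (F (int \<nu> + 1) * monom2 \<nu> l) = 1" for \<nu>
    using L_F[of \<nu> \<nu> l] g0(2) t0 by (simp add: power_add)
  have NK: "N + K < 2 * n" and l: "l \<le> m" and pos: "coeff (g 0) l > 0"
    using K_le_N n m g0(2) t0 by auto
  note e = entries_of_cheb_family[where g = g and K = "N + K" and m = m and n = n and l = l and k = k,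
      OF g_degree[OF m] NK g0(1) l pos orth norm k]
  show "A_entry n m k l = (if k = l then 1 / 2 else 0)" and "B_entry n m k l = 0"
    using e by blast+
qed

end

section \<open>Exchanging the variables\<close>

text \<open>Exchange of x and y, which is not a coefficientwise operation on nested polynomials;
  summing over the finite support avoids any choice of degree bounds.\<close>

definition swap2 :: "real poly poly \<Rightarrow> real poly poly" where
  "swap2 p = (\<Sum>(i, j)\<in>{(i, j). coeff (coeff p i) j \<noteq> 0}. smult [:coeff (coeff p i) j:] (monom2 j i))"

lemma finite_supp: "finite {(i, j). coeff (coeff p i) j \<noteq> 0}"
proof (rule finite_subset)
  have "i \<le> degree p \<and> j \<le> degree (coeff p i)" if "coeff (coeff p i) j \<noteq> 0" for i j
    using that le_degree by (metis coeff_0)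
  then show "{(i, j). coeff (coeff p i) j \<noteq> 0} \<subseteq> Sigma {..degree p} (\<lambda>i. {..degree (coeff p i)})"
    by auto
qed auto

lemma coeff_swap2: "coeff (coeff (swap2 p) a) b = coeff (coeff p b) a"
proof -
  let ?S = "{(i, j). coeff (coeff p i) j \<noteq> 0}"
  have "coeff (coeff (swap2 p) a) b = (\<Sum>x\<in>?S. if x = (b, a) then coeff (coeff p b) a else 0)"
    by (simp add: swap2_def coeff_sum case_prod_beta coeff_monom2)
       (intro sum.cong refl, auto)
  then show ?thesis
    by (simp add: finite_supp)
qed

lemma swap2_swap2: "swap2 (swap2 p) = p"
  by (intro poly_eqI) (simp add: coeff_swap2)

lemma eval2_sum: "eval2 (sum f A) x y = (\<Sum>a\<in>A. eval2 (f a) x y)"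
  by (simp add: eval2_def poly_sum)

lemma eval2_swap2: "eval2 (swap2 p) x y = eval2 p y x"
proof -
  let ?S = "{(i, j). coeff (coeff p i) j \<noteq> 0}"
  have "eval2 p y x = eval2 (\<Sum>(i, j)\<in>?S. smult [:coeff (coeff p i) j:] (monom2 i j)) y x"
    by (subst supp_in_expand[OF finite_supp[of p], of p]) (auto simp: supp_in_def)
  then show ?thesis
    by (simp add: swap2_def eval2_sum case_prod_beta eval2_smult eval2_monom2 mult_ac)
qed

context chebyshev_weight
begin

text \<open>Symmetry of the weight and the two orders of iterated integration.\<close>

lemma L_swap:
  assumes d_sym: "\<And>x y. d x y = d y x"
    and "\<And>x y. eval2 p x y = eval2 q y x"
  shows "L p = L q"
proof -
  have "weight x y = weight y x" for x y
    using d_sym by (simp add: weight_def mult_ac)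
  then show ?thesis
    unfolding L_alt weighted_measure_iterated(1)[OF continuous_on_eval2, of p]
      weighted_measure_iterated(2)[OF continuous_on_eval2, of q]
    using assms(2) by simp
qed

text \<open>The reverse order is the lexicographic order after the exchange, so \<open>n\<close> and
  \<open>m\<close> trade places in \<open>onp\<close>.\<close>

lemma is_rlex_onp_eq:
  assumes d_sym: "\<And>x y. d x y = d y x"
  shows "is_rlex_onp (weighted_measure d) n m l p \<longleftrightarrow> onp m n l (swap2 p)"
proof -
  have sq: "(\<integral>(x, y). (eval2 p x y)\<^sup>2 \<partial>weighted_measure d) = L (swap2 p * swap2 p)"
    using L_swap[OF d_sym, of "p * p" "swap2 p * swap2 p"]
    by (simp add: L_def eval2_mult eval2_swap2 power2_eq_square)
  have orth: "(\<integral>(x, y). eval2 p x y * (x ^ i * y ^ j) \<partial>weighted_measure d) = L (swap2 p * monom2 j i)" for i j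
    using L_swap[OF d_sym, of "p * monom2 i j" "swap2 p * monom2 j i"]
    by (simp add: L_def eval2_mult eval2_swap2 eval2_monom2 mult_ac)
  show ?thesis
    unfolding is_rlex_onp_def onp_def sq orth supp_in_def coeff_swap2 lex_le_def lex_less_def
    by auto
qed

lemma rlex_onp_eq:
  assumes d_sym: "\<And>x y. d x y = d y x" and "l \<le> n"
  shows "rlex_onp (weighted_measure d) n m l = swap2 (the_onp m n l)"
  unfolding rlex_onp_def is_rlex_onp_eq[OF d_sym]
proof (rule the_equality)
  show "onp m n l (swap2 (swap2 (the_onp m n l)))"
    unfolding swap2_swap2 by (rule the_onp[OF \<open>l \<le> n\<close>])
next
  fix p assume "onp m n l (swap2 p)"
  then have "the_onp m n l = swap2 p"
    using \<open>l \<le> n\<close> by (rule the_onp_eq)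
  then show "p = swap2 (the_onp m n l)"
    by (simp add: swap2_swap2)
qed

lemma L_y_mult:
  assumes d_sym: "\<And>x y. d x y = d y x"
  shows "(\<integral>(x, y). y * eval2 (swap2 p) x y * eval2 (swap2 q) x y \<partial>weighted_measure d) = L (X * p * q)"
  using L_swap[OF d_sym, of "swap2 (X * p * q)" "X * p * q"]
  by (simp add: L_def eval2_mult eval2_swap2 eval2_X mult.assoc del: mult_pCons_left)

lemma A_rlex_eq:
  assumes "\<And>x y. d x y = d y x"
  shows "A_rlex (weighted_measure d) n m = Matrix.mat (n + 1) (n + 1) (\<lambda>(k, l). A_entry m n k l)"
  unfolding A_rlex_def A_entry_def
  by (intro cong_mat) (simp_all add: rlex_onp_eq[OF assms] L_y_mult[OF assms] del: mult_pCons_left)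

lemma B_rlex_eq:
  assumes "\<And>x y. d x y = d y x"
  shows "B_rlex (weighted_measure d) n m = Matrix.mat (n + 1) (n + 1) (\<lambda>(k, l). B_entry m n k l)"
  unfolding B_rlex_def B_entry_def
  by (intro cong_mat) (simp_all add: rlex_onp_eq[OF assms] L_y_mult[OF assms] del: mult_pCons_left)

end

context product_weight
begin

text \<open>With \<open>D = m - l\<close> a suitable T exists for every \<open>l \<le> m\<close>, in
  contrast to part (a); hence no exceptional block remains.\<close>

lemma entries:
  assumes "N < n" "N \<le> m" "k \<le> m" "l \<le> m"
  shows "A_entry n m k l = (if k = l then 1 / 2 else 0)" and "B_entry n m k l = 0"
proof -
  obtain K t where "K \<le> N" "K \<le> m - l" "t 0 > 0"
    "\<forall>r\<le>m - l. integral {0..1} (\<lambda>x. circ (of_int (- int r) * x) * szego_weight K t x) =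
       (if r = 0 then complex_of_real (1 / t 0) else 0)"
    using szego_polynomial_exists by blast
  then interpret szego_family N c K "m - l" l t
    by unfold_locales auto
  show "A_entry n m k l = (if k = l then 1 / 2 else 0)" and "B_entry n m k l = 0"
    using szego_entries[of m n k] assms by auto
qed

lemma matrices:
  assumes "N < n" "N < m"
  shows "A_lex (weighted_measure dens) n m = (1 / 2) \<cdot>\<^sub>m 1\<^sub>m (m + 1)"
    and "B_lex (weighted_measure dens) n m = 0\<^sub>m (m + 1) (m + 1)"
    and "A_rlex (weighted_measure dens) n m = (1 / 2) \<cdot>\<^sub>m 1\<^sub>m (n + 1)"
    and "B_rlex (weighted_measure dens) n m = 0\<^sub>m (n + 1) (n + 1)"
  unfolding A_lex_eq B_lex_eq A_rlex_eq[OF dens_sym] B_rlex_eq[OF dens_sym]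
  using assms by (auto intro!: eq_matI simp: entries)

end

section \<open>Assembly: the concrete densities as instances\<close>

lemma omega_coefficients:
  "\<exists>c. c 0 = 1 \<and> (\<forall>s. (\<Prod>i=1..N. 1 + complex_of_real (a i) * s) = (\<Sum>q\<le>N. complex_of_real (c q) * s ^ q))"
proof (induction N)
  case 0
  show ?case by (intro exI[of _ "\<lambda>_. 1"]) simp
next
  case (Suc N)
  then obtain c where c0: "c 0 = 1" and
    c: "\<And>s. (\<Prod>i=1..N. 1 + complex_of_real (a i) * s) = (\<Sum>q\<le>N. complex_of_real (c q) * s ^ q)"
    by auto
  define c' where "c' q = (if q \<le> N then c q else 0) + (case q of 0 \<Rightarrow> 0 | Suc p \<Rightarrow> a (Suc N) * c p)" for q
  have "(\<Sum>q\<le>Suc N. complex_of_real (c' q) * s ^ q) = (\<Prod>i=1..Suc N. 1 + complex_of_real (a i) * s)" for s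
  proof -
    have "(\<Sum>q\<le>Suc N. complex_of_real (c' q) * s ^ q) =
        (\<Sum>q\<le>Suc N. complex_of_real (if q \<le> N then c q else 0) * s ^ q) +
        (\<Sum>q\<le>Suc N. complex_of_real (case q of 0 \<Rightarrow> 0 | Suc p \<Rightarrow> a (Suc N) * c p) * s ^ q)"
      by (simp only: c'_def of_real_add distrib_right sum.distrib)
    also have "(\<Sum>q\<le>Suc N. complex_of_real (if q \<le> N then c q else 0) * s ^ q) = (\<Sum>q\<le>N. complex_of_real (c q) * s ^ q)"
      by simp
    also have "(\<Sum>q\<le>Suc N. complex_of_real (case q of 0 \<Rightarrow> 0 | Suc p \<Rightarrow> a (Suc N) * c p) * s ^ q) =
        complex_of_real (a (Suc N)) * s * (\<Sum>q\<le>N. complex_of_real (c q) * s ^ q)"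
      by (subst sum.atMost_Suc_shift) (simp add: sum_distrib_left mult_ac)
    also have "(\<Sum>q\<le>N. complex_of_real (c q) * s ^ q) +
        complex_of_real (a (Suc N)) * s * (\<Sum>q\<le>N. complex_of_real (c q) * s ^ q) =
        (\<Prod>i=1..N. 1 + complex_of_real (a i) * s) * (1 + complex_of_real (a (Suc N)) * s)"
      unfolding c by (simp add: algebra_simps)
    finally show ?thesis
      by simp
  qed
  then show ?case
    using c0 by (intro exI[of _ c']) (auto simp: c'_def)
qed

lemma weighted_measure_cong:
  assumes "\<And>x y. \<lbrakk>-1 \<le> x; x \<le> 1; -1 \<le> y; y \<le> 1\<rbrakk> \<Longrightarrow> d x y = d' x y"
  shows "weighted_measure d = weighted_measure d'"
  unfolding weighted_measure_def using assms
  by (intro arg_cong[where f = "density lborel"]) (auto simp: fun_eq_iff indicator_def)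

theorem theorem4p2:
  shows "(\<forall>(N::nat) (h :: nat \<Rightarrow> real poly) (\<kappa>::nat) (n::nat) (m::nat).
      N \<ge> 1 \<and> h 0 = 1 \<and>
      (\<forall>i\<le>N. real (degree (h i)) \<le> real N / 2 - \<bar>real N / 2 - real i\<bar>) \<and>
      (\<forall>(z::complex) (y::real). norm z \<le> 1 \<and> -1 \<le> y \<and> y \<le> 1 \<longrightarrow> h_eval N h z y \<noteq> 0) \<and>
      \<kappa> = Max ((\<lambda>i. degree (h i)) ` {0..N}) \<and>
      int n \<ge> \<lceil>(real N + 1) / 2\<rceil> \<and> int m \<ge> int \<kappa> - 1
      \<longrightarrow>
      (\<exists>C D. C \<in> carrier_mat \<kappa> \<kappa> \<and> D \<in> carrier_mat \<kappa> \<kappa> \<and>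
         (\<forall>i<\<kappa>. \<forall>j<\<kappa>. i < j \<longrightarrow> C $$ (i, j) = 0) \<and>
         (\<forall>i<\<kappa>. C $$ (i, i) > 0) \<and>
         transpose_mat D = D \<and>
         A_lex (mu_h N h) n m =
           four_block_mat ((1 / 2) \<cdot>\<^sub>m 1\<^sub>m (m + 1 - \<kappa>)) (0\<^sub>m (m + 1 - \<kappa>) \<kappa>)
                          (0\<^sub>m \<kappa> (m + 1 - \<kappa>)) C \<and>
         B_lex (mu_h N h) n m =
           four_block_mat (0\<^sub>m (m + 1 - \<kappa>) (m + 1 - \<kappa>)) (0\<^sub>m (m + 1 - \<kappa>) \<kappa>)
                          (0\<^sub>m \<kappa> (m + 1 - \<kappa>)) D))
    \<and>
    (\<forall>(N::nat) (a :: nat \<Rightarrow> real) (n::nat) (m::nat).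
      N \<ge> 1 \<and> (\<forall>i\<in>{1..N}. 0 < \<bar>a i\<bar> \<and> \<bar>a i\<bar> < 1) \<and> n > 2 * N \<and> m > 2 * N
      \<longrightarrow>
      A_lex (mu_omega N a) n m = (1 / 2) \<cdot>\<^sub>m 1\<^sub>m (m + 1) \<and>
      B_lex (mu_omega N a) n m = 0\<^sub>m (m + 1) (m + 1) \<and>
      A_rlex (mu_omega N a) n m = (1 / 2) \<cdot>\<^sub>m 1\<^sub>m (n + 1) \<and>
      B_rlex (mu_omega N a) n m = 0\<^sub>m (n + 1) (n + 1))"
proof (rule conjI; intro allI impI; elim conjE)
  fix N n m \<kappa> :: nat and h :: "nat \<Rightarrow> real poly"
  assume h: "h 0 = 1" "\<forall>z y. norm z \<le> 1 \<and> -1 \<le> y \<and> y \<le> 1 \<longrightarrow> h_eval N h z y \<noteq> 0"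
    and \<kappa>: "\<kappa> = Max ((\<lambda>i. degree (h i)) ` {0..N})"
    and n: "\<lceil>(real N + 1) / 2\<rceil> \<le> int n" and m: "int \<kappa> - 1 \<le> int m"
  interpret bernstein_szego_weight N h
    using h by unfold_locales auto
  have deg: "degree (h i) \<le> \<kappa>" if "i \<le> N" for i
    unfolding \<kappa> using that by (intro Max_ge) auto
  \<comment> \<open>The ceiling bound in integer form, which is the leading-term condition at level
    \<open>n - 1\<close> for a family of length \<open>N\<close>.\<close>
  have "N < 2 * n"
    using n by (simp add: ceiling_le_iff)
  show "\<exists>C D. C \<in> carrier_mat \<kappa> \<kappa> \<and> D \<in> carrier_mat \<kappa> \<kappa> \<and>
         (\<forall>i<\<kappa>. \<forall>j<\<kappa>. i < j \<longrightarrow> C $$ (i, j) = 0) \<and>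
         (\<forall>i<\<kappa>. C $$ (i, i) > 0) \<and>
         transpose_mat D = D \<and>
         A_lex (mu_h N h) n m =
           four_block_mat ((1 / 2) \<cdot>\<^sub>m 1\<^sub>m (m + 1 - \<kappa>)) (0\<^sub>m (m + 1 - \<kappa>) \<kappa>)
                          (0\<^sub>m \<kappa> (m + 1 - \<kappa>)) C \<and>
         B_lex (mu_h N h) n m =
           four_block_mat (0\<^sub>m (m + 1 - \<kappa>) (m + 1 - \<kappa>)) (0\<^sub>m (m + 1 - \<kappa>) \<kappa>)
                          (0\<^sub>m \<kappa> (m + 1 - \<kappa>)) D"
    by (rule block_form[OF deg \<open>N < 2 * n\<close>]) (use m in auto)
next
  fix N n m :: nat and a :: "nat \<Rightarrow> real"
  assume a: "\<forall>i\<in>{1..N}. 0 < \<bar>a i\<bar> \<and> \<bar>a i\<bar> < 1" and n: "2 * N < n" and m: "2 * N < m"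
  obtain c where c0: "c 0 = 1" and
    c: "\<And>s. (\<Prod>i=1..N. 1 + complex_of_real (a i) * s) = (\<Sum>q\<le>N. complex_of_real (c q) * s ^ q)"
    using omega_coefficients by blast
  have "1 + complex_of_real (a i) * s \<noteq> 0" if "norm s \<le> 1" "i \<in> {1..N}" for s i
  proof
    assume "1 + complex_of_real (a i) * s = 0"
    then have "norm (complex_of_real (a i) * s) = 1"
      by (metis add_eq_0_iff norm_minus_cancel norm_one)
    moreover have "norm (complex_of_real (a i) * s) \<le> \<bar>a i\<bar> * 1"
      unfolding norm_mult norm_of_real using that(1) by (intro mult_left_mono) auto
    ultimately show False
      using a that(2) by fastforce
  qed
  then interpret product_weight N c
    by unfold_locales (simp_all add: c0 flip: c)
  have om: "omega N a z w = om (z * w)" for z w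
    by (simp add: omega_def om_def mult.assoc flip: c)
  have "mu_omega N a = weighted_measure dens"
    unfolding mu_omega_def
  proof (rule weighted_measure_cong)
    \<comment> \<open>Only on the unit circle is the inverse of w its conjugate, so the two
      densities are compared on the square alone, outside of which the measure does not see
      them.\<close>
    fix x y :: real assume "-1 \<le> y" "y \<le> 1"
    then have "1 / circle_pt y = cnj (circle_pt y)"
      using complex_div_cnj[of 1 "circle_pt y"] norm_circle_pt[of y] by simp
    then show "(norm (omega N a (circle_pt x) (circle_pt y) * omega N a (circle_pt x) (1 / circle_pt y)))\<^sup>2 = dens x y"
      by (simp only: om)
  qed
  then show "A_lex (mu_omega N a) n m = (1 / 2) \<cdot>\<^sub>m 1\<^sub>m (m + 1) \<and>
      B_lex (mu_omega N a) n m = 0\<^sub>m (m + 1) (m + 1) \<and>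
      A_rlex (mu_omega N a) n m = (1 / 2) \<cdot>\<^sub>m 1\<^sub>m (n + 1) \<and>
      B_rlex (mu_omega N a) n m = 0\<^sub>m (n + 1) (n + 1)"
    using matrices[of n m] n m by simp
qed

end
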